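(* Let $\rho$ be a normalized fermionic state of a system $\mathsf{L}_\mathsf{F}$ of $L$ local fermionic modes, and let $S_f(\rho):=-\operatorname{Tr}[J(\rho)\log_2 J(\rho)]$ be its von Neumann entropy. (Direct part) For every $\delta>0$ and every $R>S_f(\rho)$ there exists $N_0$ such that for every $N\geq N_0$ there is a fermionic compression scheme $(\mathcal{E}_N,\mathcal{D}_N)$ of rate $R$ with $F(\rho^{\boxtimes N},\mathcal{D}_N\mathcal{E}_N)\geq 1-\delta$. (Converse part) For every $R<S_f(\rho)$ and every $\delta>0$ there exists $N_0$ such that for every $N\ge N_0$ and every fermionic compression scheme $(\mathcal{E}_N,\mathcal{D}_N)$ of rate $R$ one has $F(\rho^{\boxtimes N},\mathcal{D}_N\mathcal{E}_N)\leq\delta$.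
   Context: Fermionic systems: a system $\mathsf{L}_\mathsf{F}$ of $L$ local fermionic modes (LFMs) is described by field operators $\varphi_1,\dots,\varphi_L$ with $\{\varphi_i,\varphi_j^\dagger\}=\delta_{ij}I$, $\{\varphi_i,\varphi_j\}=0$. The vacuum $|\Omega\rangle$ is the common $0$-eigenvector of all $\varphi_i^\dagger\varphi_i$, and the Fock basis $|n_1,\dots,n_L\rangle=(\varphi_1^\dagger)^{n_1}\cdots(\varphi_L^\dagger)^{n_L}|\Omega\rangle$, $n_i\in\{0,1\}$, spans the Fock space $\mathcal{F}_L$ (dimension $2^L$). Identifying this basis with the computational basis of $L$ qubits $\mathcal{H}_L=(\mathbb{C}^2)^{\otimes L}$ gives the Jordan–Wigner isomorphism $J$, determined by an ordering of the modes: $J(\varphi_i)=(\bigotimes_{l<i}\sigma^z_l)\otimes\sigma^-_i\otimes(\bigotimes_{k>i}I_k)$, extended linearly and multiplicatively with $J(X^\dagger)=J(X)^\dagger$; different orderings give unitarily equivalent representations. $\mathcal{F}_L=\mathcal{F}_L^e\oplus\mathcal{F}_L^o$ is the splitting into even/odd total occupation number. A fermionic state is a linear combination of products of an even number of field operators whose representative is $J(\rho)=\rho_e+\rho_o$ with $\rho_e,\rho_o\ge0$ supported on the even/odd subspace and trace $\le1$; normalized states have trace 1, pure states have rank-one representatives. The composite of $\mathsf{L}_\mathsf{F}$ and $\mathsf{M}_\mathsf{F}$, written $\mathsf{L}_\mathsf{F}\boxtimes\mathsf{M}_\mathsf{F}$ or $\mathsf{L}_\mathsf{F}\mathsf{M}_\mathsf{F}$,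 is the system of $L+M$ LFMs; $\rho^{\boxtimes N}$ is the product state of $N$ copies (with $J(\rho^{\boxtimes N})=J(\rho)^{\otimes N}$ for the ordering listing the copies consecutively). The fermionic partial trace $\operatorname{Tr}^f_{\mathsf{M}_\mathsf{F}}$ drops every term containing an odd number of field operators of some mode of $\mathsf{M}_\mathsf{F}$ and then removes the field operators of the $\mathsf{M}_\mathsf{F}$ modes from the remaining terms. Fermionic transformations are completely positive maps (in the Jordan–Wigner representation) whose Kraus operators each are linear combinations of products of field operators with either all an even or all an odd number of factors; channels are the trace-preserving ones. The parallel composition $\mathcal{C}\boxtimes\mathcal{D}$ has Kraus operators $\{C_iD_j\}$, and $\mathcal{I}$ denotes the identity channel. Fidelities: $\rho^{1/2}:=J^{-1}[J(\rho)^{1/2}]$; the Uhlmann fidelity of states is $F(\rho,\sigma):=\operatorname{Tr}[J(\rho^{1/2}\sigma\rho^{1/2})^{1/2}]$. A purification of $\rho\in\mathsf{St}(\mathsf{L}_\mathsf{F})$ is a pure state $\Phi_\rho$ of some $\mathsf{L}_\mathsf{F}\mathsf{K}_\mathsf{F}$ with $\operatorname{Tr}^f_{\mathsf{K}_\mathsf{F}}\Phi_\rho=\rho$. For a normalized state $\rho$ and a channel $\mathcal{C}$, the entanglement fidelity is $F(\rho,\mathcal{C}):=F(\Phi_\rho,(\mathcal{C}\boxtimes\mathcal{I})(\Phi_\rho))^2$ (independent of the choice of purification). Compression scheme: for $N$ copies, an encoding channel $\mathcal{E}_N$ from $\mathsf{L}_\mathsf{F}^{\boxtimes N}$ to a system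 $\mathsf{M}_\mathsf{F}$ of $M$ LFMs and a decoding channel $\mathcal{D}_N$ from $\mathsf{M}_\mathsf{F}$ back to $\mathsf{L}_\mathsf{F}^{\boxtimes N}$; its rate is $\log_2 d_{\mathcal{F}_M}(N)/N$, where $d_{\mathcal{F}_M}(N)$ is the dimension of the Fock space used to carry the compressed state; "rate $R$" means this quantity does not exceed $R$. *)

theory Defs
  imports "Jordan_Normal_Form.Schur_Decomposition" "Jordan_Normal_Form.Char_Poly"
    "HOL-Computational_Algebra.Polynomial"
begin

text \<open>Everything is expressed in the Jordan-Wigner representation: an operator on a
  system of n local fermionic modes is a complex 2^n x 2^n matrix; the Fock basis
  vector with occupation numbers n_1..n_n is the basis index whose binary expansion
  is n_1 ... n_n (mode 1 = most significant bit).  Composite systems list the modes of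
  the first system first, so J(rho boxtimes sigma) = J(rho) tensor J(sigma).\<close>

definition mtrace :: "complex mat \<Rightarrow> complex" where
  "mtrace A = (\<Sum>i<dim_row A. A $$ (i, i))"

definition kron :: "complex mat \<Rightarrow> complex mat \<Rightarrow> complex mat" where
  "kron A B = mat (dim_row A * dim_row B) (dim_col A * dim_col B)
     (\<lambda>(i, j). A $$ (i div dim_row B, j div dim_col B) * B $$ (i mod dim_row B, j mod dim_col B))"

fun kron_pow :: "complex mat \<Rightarrow> nat \<Rightarrow> complex mat" where
  "kron_pow A 0 = 1\<^sub>m 1"
| "kron_pow A (Suc N) = kron A (kron_pow A N)"

definition psd :: "nat \<Rightarrow> complex mat \<Rightarrow> bool" where
  "psd n A \<longleftrightarrow> A \<in> carrier_mat n n \<and>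
     (\<forall>v \<in> carrier_vec n. Im (conjugate v \<bullet> (A *\<^sub>v v)) = 0 \<and> Re (conjugate v \<bullet> (A *\<^sub>v v)) \<ge> 0)"

definition psd_sqrt :: "complex mat \<Rightarrow> complex mat" where
  "psd_sqrt A = (THE B. psd (dim_row A) B \<and> B * B = A)"

definition ptrace_last :: "nat \<Rightarrow> nat \<Rightarrow> complex mat \<Rightarrow> complex mat" where
  "ptrace_last n k X = mat (2 ^ n) (2 ^ n)
     (\<lambda>(i, j). \<Sum>a<2 ^ k. X $$ (i * 2 ^ k + a, j * 2 ^ k + a))"

definition outer :: "complex vec \<Rightarrow> complex mat" where
  "outer v = mat (dim_vec v) (dim_vec v) (\<lambda>(i, j). v $ i * cnj (v $ j))"

fun popcount :: "nat \<Rightarrow> nat" where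
  "popcount n = (if n = 0 then 0 else n mod 2 + popcount (n div 2))"

definition odd_occ :: "nat \<Rightarrow> bool" where
  "odd_occ i \<longleftrightarrow> odd (popcount i)"

definition ferm_state :: "nat \<Rightarrow> complex mat \<Rightarrow> bool" where
  "ferm_state n \<rho> \<longleftrightarrow> (\<exists>\<rho>e \<rho>o. psd (2 ^ n) \<rho>e \<and> psd (2 ^ n) \<rho>o \<and>
     (\<forall>i j. i < 2 ^ n \<longrightarrow> j < 2 ^ n \<longrightarrow> (odd_occ i \<or> odd_occ j) \<longrightarrow> \<rho>e $$ (i, j) = 0) \<and>
     (\<forall>i j. i < 2 ^ n \<longrightarrow> j < 2 ^ n \<longrightarrow> (\<not> odd_occ i \<or> \<not> odd_occ j) \<longrightarrow> \<rho>o $$ (i, j) = 0) \<and>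
     \<rho> = \<rho>e + \<rho>o) \<and> Re (mtrace \<rho>) \<le> 1"

definition normalized_ferm_state :: "nat \<Rightarrow> complex mat \<Rightarrow> bool" where
  "normalized_ferm_state n \<rho> \<longleftrightarrow> ferm_state n \<rho> \<and> mtrace \<rho> = 1"

text \<open>Pure normalized fermionic states: rank-one representatives v v^* of a unit
  vector v of definite parity (v lies in the even or in the odd subspace).\<close>
definition pure_ferm_vec :: "nat \<Rightarrow> complex vec \<Rightarrow> bool" where
  "pure_ferm_vec n v \<longleftrightarrow> v \<in> carrier_vec (2 ^ n) \<and> conjugate v \<bullet> v = 1 \<and>
     ((\<forall>i < 2 ^ n. odd_occ i \<longrightarrow> v $ i = 0) \<or> (\<forall>i < 2 ^ n. \<not> odd_occ i \<longrightarrow> v $ i = 0))"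

text \<open>Von Neumann entropy S_f(rho) = - Tr[J(rho) log2 J(rho)], computed on the
  eigenvalues (with multiplicity) of J(rho), with the convention 0 log 0 = 0.\<close>
definition eta :: "real \<Rightarrow> real" where
  "eta x = (if x = 0 then 0 else x * log 2 x)"

definition vn_entropy :: "complex mat \<Rightarrow> real" where
  "vn_entropy \<rho> = - sum_mset (image_mset (\<lambda>x. eta (Re x)) (proots (char_poly \<rho>)))"

text \<open>A map from n modes to m modes is represented by a finite list of Kraus
  operators (2^m x 2^n matrices).  Each Kraus operator must be of definite parity:
  even (maps even to even and odd to odd occupation) or odd (swaps them).\<close>
definition parity_definite :: "complex mat \<Rightarrow> bool" where
  "parity_definite K \<longleftrightarrow>
     (\<forall>i j. i < dim_row K \<longrightarrow> j < dim_col K \<longrightarrow> K $$ (i, j) \<noteq> 0 \<longrightarrow> odd_occ i = odd_occ j) \<or>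
     (\<forall>i j. i < dim_row K \<longrightarrow> j < dim_col K \<longrightarrow> K $$ (i, j) \<noteq> 0 \<longrightarrow> odd_occ i \<noteq> odd_occ j)"

definition msum :: "nat \<Rightarrow> complex mat list \<Rightarrow> complex mat" where
  "msum d xs = foldr (+) xs (0\<^sub>m d d)"

definition ferm_channel :: "nat \<Rightarrow> nat \<Rightarrow> complex mat list \<Rightarrow> bool" where
  "ferm_channel n m Ks \<longleftrightarrow>
     (\<forall>K \<in> set Ks. K \<in> carrier_mat (2 ^ m) (2 ^ n) \<and> parity_definite K) \<and>
     msum (2 ^ n) (map (\<lambda>K. mat_adjoint K * K) Ks) = 1\<^sub>m (2 ^ n)"

definition apply_channel :: "complex mat list \<Rightarrow> complex mat \<Rightarrow> complex mat" where
  "apply_channel Ks X = msum (dim_row (hd Ks)) (map (\<lambda>K. K * X * mat_adjoint K) Ks)"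

definition compose_channels :: "complex mat list \<Rightarrow> complex mat list \<Rightarrow> complex mat list" where
  "compose_channels Ds Es = concat (map (\<lambda>D. map (\<lambda>E. D * E) Es) Ds)"

definition extend_channel :: "nat \<Rightarrow> complex mat list \<Rightarrow> complex mat list" where
  "extend_channel k Ks = map (\<lambda>K. kron K (1\<^sub>m (2 ^ k))) Ks"

definition fidelity :: "complex mat \<Rightarrow> complex mat \<Rightarrow> real" where
  "fidelity \<rho> \<sigma> = Re (mtrace (psd_sqrt (psd_sqrt \<rho> * \<sigma> * psd_sqrt \<rho>)))"

text \<open>Purification of rho (n modes) on n + k modes; the fermionic partial trace over
  the k ancilla modes, listed last, is the ordinary partial trace of the JW
  representative over the last k qubits.\<close>
definition purification :: "nat \<Rightarrow> nat \<Rightarrow> complex mat \<Rightarrow> complex vec \<Rightarrow> bool" where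
  "purification n k \<rho> v \<longleftrightarrow> pure_ferm_vec (n + k) v \<and> ptrace_last n k (outer v) = \<rho>"

text \<open>Entanglement fidelity F(rho, C) = F(Phi_rho, (C boxtimes I)(Phi_rho))^2, for a
  (chosen) purification Phi_rho; the value does not depend on that choice.\<close>
definition ent_fidelity :: "nat \<Rightarrow> complex mat \<Rightarrow> complex mat list \<Rightarrow> real" where
  "ent_fidelity n \<rho> Cs = (SOME f. \<exists>k v. purification n k \<rho> v \<and>
      f = (fidelity (outer v) (apply_channel (extend_channel k Cs) (outer v)))\<^sup>2)"

definition compression_scheme :: "nat \<Rightarrow> nat \<Rightarrow> nat \<Rightarrow> complex mat list \<Rightarrow> complex mat list \<Rightarrow> bool" where
  "compression_scheme L N M Es Ds \<longleftrightarrow> ferm_channel (L * N) M Es \<and> ferm_channel M (L * N) Ds"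

text \<open>Rate log2 d_{F_M}(N) / N with d_{F_M}(N) = 2^M the dimension of the Fock space
  of the M modes carrying the compressed state.\<close>
definition scheme_rate :: "nat \<Rightarrow> nat \<Rightarrow> real" where
  "scheme_rate N M = log 2 (2 ^ M) / real N"

end

theory Submission
  imports Defs
begin

text \<open>For a purification of \<open>\<rho>\<close> the entanglement fidelity of a map with Kraus operators \<open>C\<^sub>k\<close> is the
  sum of \<open>|Tr (C\<^sub>k \<rho>)|\<^sup>2\<close>, whatever the purification; one of even parity is the vectorised square root of
  \<open>\<rho>\<close>. A fermionic state has eigenvectors of definite parity, hence so does \<open>\<rho>\<^sup>\<otimes>\<^sup>N\<close>, with product weights.

  Direct part: the eigenvectors of typical weight are mapped isometrically to Fock basis vectors of the
  same parity (one extra mode leaves room to adjust the parity), all others to the vacuum; the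
  fidelity is at least the square of the typical weight, which tends to 1 by Chebyshev's inequality.

  Converse part: split the spectrum of \<open>\<rho>\<^sup>\<otimes>\<^sup>N\<close> at a threshold \<open>t\<close> slightly above the typical weight. By
  Cauchy-Schwarz the fidelity is at most \<open>2 \<mu>\<^sup>2 + 2 t 2\<^sup>M\<close>, where \<open>\<mu>\<close> is the total weight above \<open>t\<close>.\<close>

subsection \<open>Adjoints and the spectral theorem\<close>

text \<open>Parity shapes the argument in two places. A degenerate eigenvalue of \<rho> can be
  shared by even and odd vectors, so an arbitrary eigenbasis may mix the parities, and a code built
  on it would have inadmissible Kraus operators. Diagonalising \<rho> + 1 multiplied by the parity
  sign separates the two sectors by the sign of the eigenvalue. Moreover \<open>ent_fidelity\<close>
  is defined by choice over purifications of definite parity, so the closed formula determines its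
  value only once such a purification has been exhibited. In the converse, encoder and decoder may
  have arbitrarily many Kraus operators, so estimating each product separately is useless. Both
  estimates therefore sum over all pairs before using completeness. The factors 2 come from
  separating the two parts of the spectrum inside a squared modulus; they are harmless because both
  terms tend to 0. In the direct part the extra mode costs only 1/N in the rate, which the gap
  between the rate and the entropy absorbs.\<close>

lemma mat_adjoint_dim [simp]:
  "dim_row (mat_adjoint A) = dim_col A" "dim_col (mat_adjoint A) = dim_row A"
  by (auto simp: mat_adjoint_def)

lemma mat_adjoint_index [simp]:
  "i < dim_col A \<Longrightarrow> j < dim_row A \<Longrightarrow> mat_adjoint A $$ (i, j) = cnj (A $$ (j, i))"
  for A :: "complex mat"
  by (simp add: mat_adjoint_def mat_of_rows_index)

lemma mat_adjoint_carrier [simp]: "A \<in> carrier_mat n m \<Longrightarrow> mat_adjoint A \<in> carrier_mat m n"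
  by auto

lemma mat_mult_index:
  assumes "A \<in> carrier_mat n m" "B \<in> carrier_mat m k" "i < n" "j < k"
  shows "(A * B) $$ (i, j) = (\<Sum>l<m. A $$ (i, l) * B $$ (l, j))"
  using assms by (auto simp: scalar_prod_def atLeast0LessThan intro!: sum.cong)

lemma mat_adjoint_mult:
  fixes A B :: "complex mat"
  assumes A: "A \<in> carrier_mat n m" and B: "B \<in> carrier_mat m k"
  shows "mat_adjoint (A * B) = mat_adjoint B * mat_adjoint A"
proof (rule eq_matI)
  fix i j assume "i < dim_row (mat_adjoint B * mat_adjoint A)" "j < dim_col (mat_adjoint B * mat_adjoint A)"
  hence ij: "i < k" "j < n" using A B by auto
  have "mat_adjoint (A * B) $$ (i, j) = cnj ((A * B) $$ (j, i))" using A B ij by simp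
  also have "\<dots> = (\<Sum>l<m. cnj (A $$ (j, l)) * cnj (B $$ (l, i)))"
    by (subst mat_mult_index[OF A B ij(2,1)]) simp
  also have "\<dots> = (mat_adjoint B * mat_adjoint A) $$ (i, j)"
    using A B ij by (subst mat_mult_index[of _ k m _ n]) (auto intro!: sum.cong)
  finally show "mat_adjoint (A * B) $$ (i, j) = (mat_adjoint B * mat_adjoint A) $$ (i, j)" .
qed (use A B in auto)

lemma mat_adjoint_adjoint [simp]: "mat_adjoint (mat_adjoint A) = A" for A :: "complex mat"
  by (rule eq_matI) auto

lemma mat_adjoint_one [simp]: "mat_adjoint (1\<^sub>m n :: complex mat) = 1\<^sub>m n"
  by (rule eq_matI) auto

lemma mat_diag_index [simp]: "i < n \<Longrightarrow> j < n \<Longrightarrow> mat_diag n f $$ (i, j) = (if i = j then f j else 0)"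
  by (simp add: mat_diag_def)

lemma mat_diag_dims [simp]: "dim_row (mat_diag n f) = n" "dim_col (mat_diag n f) = n"
  by (auto simp: mat_diag_def)

definition unitary_mat :: "nat \<Rightarrow> complex mat \<Rightarrow> bool" where
  "unitary_mat n U \<longleftrightarrow> U \<in> carrier_mat n n \<and> mat_adjoint U * U = 1\<^sub>m n"

lemma unitary_mat_right:
  assumes "unitary_mat n U"
  shows "U * mat_adjoint U = 1\<^sub>m n"
  using assms mat_mult_left_right_inverse[of "mat_adjoint U" n U]
  by (auto simp: unitary_mat_def)

lemma unitary_mat_carrier: "unitary_mat n U \<Longrightarrow> U \<in> carrier_mat n n"
  by (simp add: unitary_mat_def)

lemma unitary_mat_mult:
  assumes "unitary_mat n U" "unitary_mat n V"
  shows "unitary_mat n (U * V)"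
proof -
  have U: "U \<in> carrier_mat n n" "mat_adjoint U * U = 1\<^sub>m n"
    and V: "V \<in> carrier_mat n n" "mat_adjoint V * V = 1\<^sub>m n"
    using assms by (auto simp: unitary_mat_def)
  have "mat_adjoint (U * V) * (U * V) = mat_adjoint V * ((mat_adjoint U * U) * V)"
    using U(1) V(1) by (simp add: mat_adjoint_mult[of _ n n _ n] assoc_mult_mat[of _ n n _ n _ n])
  thus ?thesis using U V by (simp add: unitary_mat_def)
qed

text \<open>Complete \<open>v\<close> to a basis, orthogonalise and normalise. Gram-Schmidt leaves
  the first vector unchanged, so \<open>c\<close> is just the inverse of its norm.\<close>

lemma unitary_mat_first_column:
  fixes v :: "complex vec"
  assumes v: "v \<in> carrier_vec n" and v0: "v \<noteq> 0\<^sub>v n"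
  obtains U c where "unitary_mat n U" "col U 0 = c \<cdot>\<^sub>v v"
proof -
  interpret cof_vec_space n "TYPE(complex)" .
  have n: "n > 0"
    using v v0 by (metis carrier_vecD eq_vecI gr0I less_nat_zero_code zero_carrier_vec)
  define b where "b = basis_completion v"
  define ws where "ws = gram_schmidt n b"
  from basis_completion[OF v v0, folded b_def]
  have dist_b: "distinct b" and indep: "\<not> lin_dep (set b)" and b: "set b \<subseteq> carrier_vec n"
    and hdb: "hd b = v" and len_b: "length b = n" by auto
  from hdb len_b n obtain vs where bv: "b = v # vs" by (cases b, auto)
  from gram_schmidt_result[OF b dist_b indep refl, folded ws_def]
  have ws: "set ws \<subseteq> carrier_vec n" "corthogonal ws" "length ws = n"
    by (auto simp: len_b)
  from gram_schmidt_hd[OF v, of vs, folded bv] have hdws: "hd ws = v" unfolding ws_def .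
  have wsi: "ws ! i \<in> carrier_vec n" if "i < n" for i using ws that by auto
  \<comment> \<open>The vectors \<open>ws\<close> are orthogonal but not normalised;
    \<open>r i\<close> is the norm of the \<open>i\<close>-th one.\<close>
  define r where "r i = sqrt (\<Sum>k<n. (cmod (ws ! i $ k))\<^sup>2)" for i
  have ip: "ws ! i \<bullet>c ws ! j = (\<Sum>k<n. ws ! i $ k * cnj (ws ! j $ k))" if "i < n" "j < n" for i j
    using wsi that by (auto simp: scalar_prod_def atLeast0LessThan intro!: sum.cong)
  have rr: "complex_of_real (r i) * complex_of_real (r i) = ws ! i \<bullet>c ws ! i" if "i < n" for i
  proof -
    have "(r i)\<^sup>2 = (\<Sum>k<n. (cmod (ws ! i $ k))\<^sup>2)"
      unfolding r_def by (simp add: sum_nonneg)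
    hence "complex_of_real (r i) * complex_of_real (r i) = of_real (\<Sum>k<n. (cmod (ws ! i $ k))\<^sup>2)"
      by (metis of_real_mult power2_eq_square)
    also have "\<dots> = ws ! i \<bullet>c ws ! i"
      unfolding ip[OF that that] of_real_sum by (intro sum.cong refl complex_norm_square)
    finally show ?thesis .
  qed
  have r0: "r i \<noteq> 0" if "i < n" for i
    using rr[OF that] corthogonalD[OF ws(2)] that ws(3) by force
  define U where "U = mat n n (\<lambda>(k, i). ws ! i $ k / of_real (r i))"
  have U: "U \<in> carrier_mat n n" by (simp add: U_def)
  have "mat_adjoint U * U = 1\<^sub>m n"
  proof (rule eq_matI)
    fix i j assume "i < dim_row (1\<^sub>m n :: complex mat)" "j < dim_col (1\<^sub>m n :: complex mat)"
    hence ij: "i < n" "j < n" by auto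
    have "(mat_adjoint U * U) $$ (i, j)
        = (\<Sum>k<n. cnj (ws ! i $ k) / of_real (r i) * (ws ! j $ k / of_real (r j)))"
      using ij U by (subst mat_mult_index[of _ n n _ n]) (auto simp: U_def)
    also have "\<dots> = (ws ! j \<bullet>c ws ! i) / (of_real (r i) * of_real (r j))"
      unfolding ip[OF ij(2,1)] sum_divide_distrib by (rule sum.cong) (auto simp: field_simps)
    also have "\<dots> = (if i = j then 1 else 0)"
    proof (cases "i = j")
      case True
      thus ?thesis using rr[OF ij(1)] r0[OF ij(1)] by auto
    next
      case False
      thus ?thesis using corthogonalD[OF ws(2), of j i] ij ws(3) by auto
    qed
    finally show "(mat_adjoint U * U) $$ (i, j) = 1\<^sub>m n $$ (i, j)" using ij by simp
  qed (use U in auto)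
  moreover have "col U 0 = (1 / of_real (r 0)) \<cdot>\<^sub>v v"
  proof -
    have "ws ! 0 = v" using hdws ws(3) n by (cases ws) auto
    thus ?thesis using n v by (intro eq_vecI) (auto simp: U_def)
  qed
  ultimately show ?thesis using that U unfolding unitary_mat_def by blast
qed

text \<open>Deflation: split off one eigenvector by a unitary change of basis and apply the
  induction hypothesis to the remaining block.\<close>

theorem hermitian_spectral:
  fixes A :: "complex mat"
  assumes "A \<in> carrier_mat n n" "mat_adjoint A = A"
  shows "\<exists>U h. unitary_mat n U \<and> A * U = U * mat_diag n (\<lambda>i. complex_of_real (h i))"
  using assms
proof (induction n arbitrary: A)
  case 0
  have "unitary_mat 0 (1\<^sub>m 0)" by (simp add: unitary_mat_def)
  moreover have "A * 1\<^sub>m 0 = 1\<^sub>m 0 * mat_diag 0 (\<lambda>i. complex_of_real 0)"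
    using 0 by (intro eq_matI) auto
  ultimately show ?case by (intro exI[of _ "1\<^sub>m 0"] exI[of _ "\<lambda>_. 0"] conjI)
next
  case (Suc m)
  let ?n = "Suc m"
  note A = Suc.prems(1)
  note [simp] = assoc_mult_mat[of _ ?n ?n _ ?n _ ?n] mult_carrier_mat[of _ ?n ?n _ ?n]
  obtain as where as: "char_poly A = (\<Prod>a\<leftarrow>as. [:- a, 1:])" "length as = ?n"
    using char_poly_factorized[OF A] by blast
  obtain e where "e \<in> set as" using as(2) by (cases as) auto
  hence "poly (char_poly A) e = 0" unfolding as(1) poly_prod_list by (force simp: prod_list_zero_iff)
  hence "eigenvalue A e" using eigenvalue_root_char_poly[OF A] by simp
  then obtain v where v: "v \<in> carrier_vec ?n" "v \<noteq> 0\<^sub>v ?n" "A *\<^sub>v v = e \<cdot>\<^sub>v v"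
    using A unfolding eigenvalue_def eigenvector_def by auto
  obtain U c where U: "unitary_mat ?n U" and U0: "col U 0 = c \<cdot>\<^sub>v v"
    using unitary_mat_first_column[OF v(1,2)] by blast
  have Uc: "U \<in> carrier_mat ?n ?n" and UU: "mat_adjoint U * U = 1\<^sub>m ?n"
    and UU': "U * mat_adjoint U = 1\<^sub>m ?n"
    using U unitary_mat_right[OF U] by (auto simp: unitary_mat_def)
  \<comment> \<open>The first column of \<open>U\<close> is an eigenvector, so the first column of
    \<open>B\<close> vanishes below the diagonal; since \<open>B\<close> is Hermitian, so does its
    first row to the right of it.\<close>
  define B where "B = mat_adjoint U * (A * U)"
  have B: "B \<in> carrier_mat ?n ?n" using A Uc by (simp add: B_def)
  have Bh: "mat_adjoint B = B"
    using A Uc Suc.prems(2) by (simp add: B_def mat_adjoint_mult[of _ ?n ?n _ ?n])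
  have UB: "U * B = A * U"
  proof -
    have "U * B = (U * mat_adjoint U) * (A * U)" using A Uc by (simp add: B_def)
    thus ?thesis using A Uc by (simp add: UU')
  qed
  have AU0: "(A * U) $$ (k, 0) = e * U $$ (k, 0)" if "k < ?n" for k
  proof -
    have "(A * U) $$ (k, 0) = (A *\<^sub>v col U 0) $ k" using A Uc that by simp
    also have "A *\<^sub>v col U 0 = e \<cdot>\<^sub>v col U 0"
      unfolding U0 using v A by (simp add: mult_mat_vec smult_smult_assoc mult.commute)
    finally show ?thesis using that Uc by simp
  qed
  have B0: "B $$ (i, 0) = (if i = 0 then e else 0)" if "i < ?n" for i
  proof -
    have "B $$ (i, 0) = (\<Sum>k<?n. mat_adjoint U $$ (i, k) * (A * U) $$ (k, 0))"
      unfolding B_def using A Uc that by (subst mat_mult_index[of _ ?n ?n _ ?n]) auto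
    also have "\<dots> = e * (\<Sum>k<?n. mat_adjoint U $$ (i, k) * U $$ (k, 0))"
      unfolding sum_distrib_left using AU0 by (intro sum.cong) (auto simp del: index_mult_mat)
    also have "(\<Sum>k<?n. mat_adjoint U $$ (i, k) * U $$ (k, 0)) = (mat_adjoint U * U) $$ (i, 0)"
      using Uc that by (subst mat_mult_index[of _ ?n ?n _ ?n]) auto
    finally show ?thesis unfolding UU using that by simp
  qed
  have Bsym: "cnj (B $$ (j, i)) = B $$ (i, j)" if "i < ?n" "j < ?n" for i j
    using mat_adjoint_index[of i B j] Bh B that by simp
  have e: "e = of_real (Re e)"
    using Bsym[of 0 0] B0[of 0] by (simp add: complex_eq_iff)
  define C where "C = mat m m (\<lambda>(i, j). B $$ (Suc i, Suc j))"
  have "mat_adjoint C = C"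
    by (rule eq_matI) (use Bsym in \<open>auto simp: C_def\<close>)
  then obtain U1 h1 where U1: "unitary_mat m U1"
    and CU1: "C * U1 = U1 * mat_diag m (\<lambda>i. complex_of_real (h1 i))"
    using Suc.IH[of C] by (auto simp: C_def)
  have U1c: "U1 \<in> carrier_mat m m" using U1 by (rule unitary_mat_carrier)
  \<comment> \<open>The block matrix with diagonal blocks 1 and \<open>U1\<close>: it fixes the
    eigenvector already found and diagonalises the rest.\<close>
  define V where "V = mat ?n ?n (\<lambda>(i, j). case (i, j) of (0, 0) \<Rightarrow> 1 | (Suc i', Suc j') \<Rightarrow> U1 $$ (i', j') | _ \<Rightarrow> 0)"
  define h where "h = case_nat (Re e) h1"
  have V: "V \<in> carrier_mat ?n ?n" by (simp add: V_def)
  have "unitary_mat ?n V" unfolding unitary_mat_def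
  proof (intro conjI V, rule eq_matI)
    fix i j assume "i < dim_row (1\<^sub>m ?n :: complex mat)" "j < dim_col (1\<^sub>m ?n :: complex mat)"
    hence ij: "i < ?n" "j < ?n" by auto
    have "(mat_adjoint V * V) $$ (i, j) = (\<Sum>k<?n. cnj (V $$ (k, i)) * V $$ (k, j))"
      using V ij by (subst mat_mult_index[of _ ?n ?n _ ?n]) auto
    also have "\<dots> = cnj (V $$ (0, i)) * V $$ (0, j) + (\<Sum>k<m. cnj (V $$ (Suc k, i)) * V $$ (Suc k, j))"
      by (rule sum.lessThan_Suc_shift)
    also have "\<dots> = (if i = j then 1 else 0)"
    proof (cases i; cases j)
      fix i' j' assume [simp]: "i = Suc i'" "j = Suc j'"
      have "(\<Sum>k<m. cnj (V $$ (Suc k, i)) * V $$ (Suc k, j)) = (mat_adjoint U1 * U1) $$ (i', j')"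
        using ij U1c by (subst mat_mult_index[of _ m m _ m]) (auto simp: V_def)
      thus ?thesis using ij U1 by (auto simp: unitary_mat_def V_def)
    qed (use ij in \<open>auto simp: V_def\<close>)
    finally show "(mat_adjoint V * V) $$ (i, j) = 1\<^sub>m ?n $$ (i, j)" using ij by simp
  qed (use V in auto)
  moreover have BV: "B * V = V * mat_diag ?n (\<lambda>i. complex_of_real (h i))"
  proof (rule eq_matI)
    fix i j assume "i < dim_row (V * mat_diag ?n (\<lambda>i. complex_of_real (h i)))"
      "j < dim_col (V * mat_diag ?n (\<lambda>i. complex_of_real (h i)))"
    hence ij: "i < ?n" "j < ?n" using V by auto
    have "(B * V) $$ (i, j) = B $$ (i, 0) * V $$ (0, j) + (\<Sum>k<m. B $$ (i, Suc k) * V $$ (Suc k, j))"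
      unfolding mat_mult_index[OF B V ij] by (rule sum.lessThan_Suc_shift)
    also have "\<dots> = V $$ (i, j) * of_real (h j)"
    proof (cases i; cases j)
      fix i' j' assume [simp]: "i = Suc i'" "j = Suc j'"
      have "(\<Sum>k<m. B $$ (i, Suc k) * V $$ (Suc k, j)) = (C * U1) $$ (i', j')"
        using ij U1c by (subst mat_mult_index[of _ m m _ m]) (auto simp: V_def C_def)
      also have "\<dots> = U1 $$ (i', j') * of_real (h1 j')"
        unfolding CU1 using U1c ij by (subst mat_diag_mult_right[of _ m]) auto
      finally show ?thesis using ij by (auto simp: V_def h_def)
    next
      fix j' assume [simp]: "i = 0" "j = Suc j'"
      have "B $$ (0, Suc k) = 0" if "k < m" for k
        using Bsym[of "Suc k" 0, symmetric] B0[of "Suc k"] that by simp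
      thus ?thesis using ij by (auto simp: V_def)
    next
      assume [simp]: "i = 0" "j = 0"
      show ?thesis using B0[of 0] e by (simp add: V_def h_def)
    next
      fix i' assume [simp]: "i = Suc i'" "j = 0"
      show ?thesis using B0[of i] ij by (simp add: V_def h_def)
    qed
    also have "\<dots> = (V * mat_diag ?n (\<lambda>i. complex_of_real (h i))) $$ (i, j)"
      using V ij by (subst mat_diag_mult_right[of _ ?n]) auto
    finally show "(B * V) $$ (i, j) = (V * mat_diag ?n (\<lambda>i. complex_of_real (h i))) $$ (i, j)" .
  qed (use B V in auto)
  ultimately have "unitary_mat ?n (U * V)" using unitary_mat_mult[OF U] by blast
  moreover have "A * (U * V) = (U * V) * mat_diag ?n (\<lambda>i. complex_of_real (h i))"
  proof -
    have "A * (U * V) = (U * B) * V" unfolding UB using A Uc V by simp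
    also have "\<dots> = U * (B * V)" using Uc B V by simp
    finally show ?thesis unfolding BV using Uc V by simp
  qed
  ultimately show ?case by blast
qed

subsection \<open>Positive matrices graded by parity\<close>

lemma qform_sum:
  fixes A :: "complex mat"
  assumes "A \<in> carrier_mat n n" "v \<in> carrier_vec n"
  shows "conjugate v \<bullet> (A *\<^sub>v v) = (\<Sum>i<n. cnj (v $ i) * (\<Sum>k<n. A $$ (i, k) * v $ k))"
  using assms by (auto simp: scalar_prod_def atLeast0LessThan intro!: sum.cong)

lemma psd_qform:
  assumes "psd n A"
  shows "Im (\<Sum>i<n. cnj (w i) * (\<Sum>k<n. A $$ (i, k) * w k)) = 0"
    "Re (\<Sum>i<n. cnj (w i) * (\<Sum>k<n. A $$ (i, k) * w k)) \<ge> 0"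
proof -
  have A: "A \<in> carrier_mat n n" using assms by (simp add: psd_def)
  have "conjugate (vec n w) \<bullet> (A *\<^sub>v vec n w) = (\<Sum>i<n. cnj (w i) * (\<Sum>k<n. A $$ (i, k) * w k))"
    unfolding qform_sum[OF A vec_carrier] by (intro sum.cong) auto
  moreover have "vec n w \<in> carrier_vec n" by simp
  ultimately show "Im (\<Sum>i<n. cnj (w i) * (\<Sum>k<n. A $$ (i, k) * w k)) = 0"
    "Re (\<Sum>i<n. cnj (w i) * (\<Sum>k<n. A $$ (i, k) * w k)) \<ge> 0"
    using assms unfolding psd_def by metis+
qed

text \<open>Polarisation: \<open>psd\<close> only says that the quadratic form is real and
  nonnegative. Testing it on e_i + c e_j with c = 0 makes the diagonal real; c = 1 and c = i then
  compare imaginary and real parts of the two off-diagonal entries.\<close>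

lemma psd_hermitian:
  assumes "psd n A"
  shows "mat_adjoint A = A"
proof (rule eq_matI)
  have A: "A \<in> carrier_mat n n" using assms by (simp add: psd_def)
  show "dim_row (mat_adjoint A) = dim_row A" "dim_col (mat_adjoint A) = dim_col A" using A by auto
  have two: "(\<Sum>k<n. f k * ((if k = i then 1 else 0) + (if k = j then c else 0))) = f i + c * f j"
    if "i < n" "j < n" for f :: "nat \<Rightarrow> complex" and c i j
    using that by (simp add: distrib_left sum.distrib if_distrib[of "\<lambda>x. _ * x"] cong: if_cong)
  have ex: "Im (A $$ (i, i) + c * A $$ (i, j) + cnj c * (A $$ (j, i) + c * A $$ (j, j))) = 0"
    if "i < n" "j < n" for c i j
  proof -
    let ?w = "\<lambda>k. (if k = i then 1 else 0) + (if k = j then c else 0)"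
    have "(\<Sum>l<n. cnj (?w l) * (\<Sum>k<n. A $$ (l, k) * ?w k))
        = (\<Sum>l<n. (A $$ (l, i) + c * A $$ (l, j)) * ((if l = i then 1 else 0) + (if l = j then cnj c else 0)))"
      by (subst two[OF that]) (auto intro!: sum.cong simp: mult.commute)
    also have "\<dots> = A $$ (i, i) + c * A $$ (i, j) + cnj c * (A $$ (j, i) + c * A $$ (j, j))"
      by (rule two[OF that])
    finally show ?thesis using psd_qform(1)[OF assms, of ?w] by simp
  qed
  fix i j assume "i < dim_row A" "j < dim_col A"
  hence ij: "i < n" "j < n" using A by auto
  show "mat_adjoint A $$ (i, j) = A $$ (i, j)"
    using ex[OF ij, of 0] ex[OF ij(2,1), of 0] ex[OF ij, of 1] ex[OF ij, of \<i>] A ij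
    by (simp add: complex_eq_iff)
qed

lemma psd_add:
  assumes "psd n A" "psd n B"
  shows "psd n (A + B)"
  using assms unfolding psd_def
  by (auto simp: add_mult_distrib_mat_vec[of _ n n] scalar_prod_add_distrib[of _ n])

text \<open>Any eigenbasis of \<open>H\<close>, the matrix A + 1 with its rows signed by the grade,
  is also one of \<open>A\<close>. On one sector \<open>H\<close> has spectrum at least 1, on the
  other at most -1, so no eigenvector of \<open>H\<close> can have components in both.\<close>

lemma psd_graded_eigenbasis:
  assumes psd: "psd d A"
    and graded: "\<And>i j. i < d \<Longrightarrow> j < d \<Longrightarrow> A $$ (i, j) \<noteq> 0 \<Longrightarrow> s i = s j"
  obtains U p g where "unitary_mat d U" "A * U = U * mat_diag d (\<lambda>i. complex_of_real (p i))"
    "\<And>j. j < d \<Longrightarrow> p j \<ge> 0" "\<And>i j. i < d \<Longrightarrow> j < d \<Longrightarrow> U $$ (i, j) \<noteq> 0 \<Longrightarrow> s i = (g j :: bool)"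
proof -
  have A: "A \<in> carrier_mat d d" using psd by (simp add: psd_def)
  have Ah: "cnj (A $$ (j, i)) = A $$ (i, j)" if "i < d" "j < d" for i j
    using mat_adjoint_index[of i A j] psd_hermitian[OF psd] A that by simp
  define \<sigma> where "\<sigma> b = (if b then -1 else 1 :: real)" for b
  \<comment> \<open>Adding the identity moves the spectrum away from 0; otherwise the kernels of
    \<open>A\<close> in the two sectors would share the eigenvalue 0 of the signed matrix.\<close>
  define H where "H = mat d d (\<lambda>(i, j). of_real (\<sigma> (s i)) * (A $$ (i, j) + (if i = j then 1 else 0)))"
  have H: "H \<in> carrier_mat d d" by (simp add: H_def)
  have "mat_adjoint H = H"
  proof (rule eq_matI)
    fix i j assume "i < dim_row H" "j < dim_col H"
    hence ij: "i < d" "j < d" using H by auto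
    show "mat_adjoint H $$ (i, j) = H $$ (i, j)"
      using ij graded[OF ij] Ah[OF ij] by (cases "A $$ (i, j) = 0") (auto simp: H_def)
  qed (use H in auto)
  then obtain U h where U: "unitary_mat d U" and HU: "H * U = U * mat_diag d (\<lambda>i. complex_of_real (h i))"
    using hermitian_spectral[OF H] by blast
  have Uc: "U \<in> carrier_mat d d" using U by (rule unitary_mat_carrier)
  \<comment> \<open>The sign is its own inverse, so multiplying the eigenvalue equation of
    \<open>H\<close> by it recovers the action of \<open>A\<close>, with a factor that still depends
    on the grade of the row.\<close>
  have eig: "(\<Sum>k<d. A $$ (i, k) * U $$ (k, j)) = of_real (\<sigma> (s i) * h j - 1) * U $$ (i, j)"
    if ij: "i < d" "j < d" for i j
  proof -
    have "U $$ (i, j) * of_real (h j) = (H * U) $$ (i, j)"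
      unfolding HU using Uc ij by (subst mat_diag_mult_right[of _ d]) auto
    also have "\<dots> = (\<Sum>k<d. of_real (\<sigma> (s i)) * (A $$ (i, k) * U $$ (k, j)) + (if k = i then of_real (\<sigma> (s i)) * U $$ (k, j) else 0))"
      unfolding mat_mult_index[OF H Uc ij] using ij by (intro sum.cong) (auto simp: H_def algebra_simps)
    also have "\<dots> = of_real (\<sigma> (s i)) * ((\<Sum>k<d. A $$ (i, k) * U $$ (k, j)) + U $$ (i, j))"
      using ij by (simp add: sum.distrib sum_distrib_left distrib_left)
    finally have "of_real (\<sigma> (s i)) * (U $$ (i, j) * of_real (h j))
        = of_real (\<sigma> (s i)) * of_real (\<sigma> (s i)) * ((\<Sum>k<d. A $$ (i, k) * U $$ (k, j)) + U $$ (i, j))" by simp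
    moreover have "complex_of_real (\<sigma> (s i)) * of_real (\<sigma> (s i)) = 1" by (simp add: \<sigma>_def)
    ultimately show ?thesis by (simp add: algebra_simps)
  qed
  \<comment> \<open>Testing positivity of \<open>A\<close> on the degree-\<open>b\<close> part of an eigenvector of \<open>H\<close> bounds its
    eigenvalue away from 0, on a side that depends on \<open>b\<close>.\<close>
  have one: "\<sigma> (s i) * h j \<ge> 1" if ij: "i < d" "j < d" and nz: "U $$ (i, j) \<noteq> 0" for i j
  proof -
    define w where "w k = (if s k = s i then U $$ (k, j) else 0)" for k
    have "(\<Sum>k<d. A $$ (l, k) * w k) = of_real (\<sigma> (s i) * h j - 1) * w l" if l: "l < d" for l
    proof (cases "s l = s i")
      case True
      have "(\<Sum>k<d. A $$ (l, k) * w k) = (\<Sum>k<d. A $$ (l, k) * U $$ (k, j))"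
        using graded[OF l] True by (intro sum.cong) (auto simp: w_def)
      thus ?thesis unfolding eig[OF l ij(2)] using True by (simp add: w_def)
    next
      case False
      have "(\<Sum>k<d. A $$ (l, k) * w k) = 0"
        using graded[OF l] False by (intro sum.neutral) (auto simp: w_def)
      thus ?thesis using False by (simp add: w_def)
    qed
    hence "(\<Sum>l<d. cnj (w l) * (\<Sum>k<d. A $$ (l, k) * w k))
        = (\<Sum>l<d. of_real ((\<sigma> (s i) * h j - 1) * (cmod (w l))\<^sup>2))"
      by (intro sum.cong refl) (simp only: lessThan_iff of_real_mult complex_norm_square ac_simps)
    hence "0 \<le> (\<sigma> (s i) * h j - 1) * (\<Sum>l<d. (cmod (w l))\<^sup>2)"
      using psd_qform(2)[OF psd, of w] by (simp add: sum_distrib_left)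
    moreover have "(\<Sum>l<d. (cmod (w l))\<^sup>2) > 0"
      using ij(1) nz by (intro sum_pos2[of _ i]) (auto simp: w_def)
    ultimately show ?thesis by (simp add: zero_le_mult_iff)
  qed
  \<comment> \<open>Undoes both the sign and the shift by the identity.\<close>
  define p where "p j = \<bar>h j\<bar> - 1" for j
  have habs: "\<sigma> (s i) * h j = \<bar>h j\<bar>" if "i < d" "j < d" "U $$ (i, j) \<noteq> 0" for i j
    using one[OF that] by (auto simp: \<sigma>_def split: if_splits)
  \<comment> \<open>A column of a unitary matrix has norm 1, hence a nonzero entry, at which the
    bound \<open>one\<close> applies.\<close>
  have "p j \<ge> 0" if j: "j < d" for j
  proof -
    have "(\<Sum>k<d. cnj (U $$ (k, j)) * U $$ (k, j)) = (mat_adjoint U * U) $$ (j, j)"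
      using Uc j by (subst mat_mult_index[of _ d d _ d]) auto
    also have "\<dots> = 1" using U j by (simp add: unitary_mat_def)
    finally obtain i where "i < d" "U $$ (i, j) \<noteq> 0"
      by (metis (no_types, lifting) lessThan_iff mult_zero_right sum.neutral zero_neq_one)
    thus ?thesis using one[of i j] habs[of i j] j by (simp add: p_def)
  qed
  moreover have "s i = (h j < 0)" if "i < d" "j < d" "U $$ (i, j) \<noteq> 0" for i j
    using one[OF that] by (auto simp: \<sigma>_def split: if_splits)
  moreover have "A * U = U * mat_diag d (\<lambda>i. complex_of_real (p i))"
  proof (rule eq_matI)
    fix i j assume "i < dim_row (U * mat_diag d (\<lambda>i. complex_of_real (p i)))"
      "j < dim_col (U * mat_diag d (\<lambda>i. complex_of_real (p i)))"
    hence ij: "i < d" "j < d" using Uc by auto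
    have "(A * U) $$ (i, j) = of_real (p j) * U $$ (i, j)"
      unfolding mat_mult_index[OF A Uc ij] eig[OF ij]
      using habs[OF ij] by (cases "U $$ (i, j) = 0") (auto simp: p_def)
    also have "\<dots> = (U * mat_diag d (\<lambda>i. complex_of_real (p i))) $$ (i, j)"
      using Uc ij by (subst mat_diag_mult_right[of _ d]) auto
    finally show "(A * U) $$ (i, j) = (U * mat_diag d (\<lambda>i. complex_of_real (p i))) $$ (i, j)" .
  qed (use A Uc in auto)
  ultimately show ?thesis using that[OF U, of p "\<lambda>j. h j < 0"] by blast
qed

lemma normalized_ferm_stateD:
  assumes "normalized_ferm_state n \<rho>"
  shows "psd (2 ^ n) \<rho>" "mtrace \<rho> = 1"
    "\<And>i j. i < 2 ^ n \<Longrightarrow> j < 2 ^ n \<Longrightarrow> \<rho> $$ (i, j) \<noteq> 0 \<Longrightarrow> odd_occ i = odd_occ j"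
proof -
  obtain \<rho>e \<rho>o where *: "psd (2 ^ n) \<rho>e" "psd (2 ^ n) \<rho>o" "\<rho> = \<rho>e + \<rho>o"
    "\<And>i j. i < 2 ^ n \<Longrightarrow> j < 2 ^ n \<Longrightarrow> odd_occ i \<or> odd_occ j \<Longrightarrow> \<rho>e $$ (i, j) = 0"
    "\<And>i j. i < 2 ^ n \<Longrightarrow> j < 2 ^ n \<Longrightarrow> \<not> odd_occ i \<or> \<not> odd_occ j \<Longrightarrow> \<rho>o $$ (i, j) = 0"
    and tr: "mtrace \<rho> = 1"
    using assms unfolding normalized_ferm_state_def ferm_state_def by metis
  show "psd (2 ^ n) \<rho>" unfolding *(3) by (rule psd_add[OF *(1,2)])
  show "mtrace \<rho> = 1" by (rule tr)
  show "odd_occ i = odd_occ j" if ij: "i < 2 ^ n" "j < 2 ^ n" and nz: "\<rho> $$ (i, j) \<noteq> 0" for i j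
  proof -
    have "\<rho>e \<in> carrier_mat (2 ^ n) (2 ^ n)" "\<rho>o \<in> carrier_mat (2 ^ n) (2 ^ n)"
      using *(1,2) by (auto simp: psd_def)
    hence "\<rho> $$ (i, j) = \<rho>e $$ (i, j) + \<rho>o $$ (i, j)" using ij *(3) by simp
    thus ?thesis using *(4)[OF ij] *(5)[OF ij] nz by (cases "odd_occ i"; cases "odd_occ j") auto
  qed
qed

section \<open>Trace and entropy in an eigenbasis\<close>

lemma mtrace_mult_commute:
  assumes A: "A \<in> carrier_mat n m" and B: "B \<in> carrier_mat m n"
  shows "mtrace (A * B) = mtrace (B * A)"
proof -
  have "mtrace (A * B) = (\<Sum>i<n. \<Sum>k<m. A $$ (i, k) * B $$ (k, i))"
    using A by (auto simp: mtrace_def mat_mult_index[OF A B] simp del: index_mult_mat(1) intro!: sum.cong)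
  also have "\<dots> = (\<Sum>k<m. \<Sum>i<n. B $$ (k, i) * A $$ (i, k))"
    by (subst sum.swap) (simp add: mult.commute)
  also have "\<dots> = mtrace (B * A)"
    using B by (auto simp: mtrace_def mat_mult_index[OF B A] simp del: index_mult_mat(1) intro!: sum.cong)
  finally show ?thesis .
qed

lemma unitary_diag_eq:
  assumes U: "unitary_mat n U" and A: "A \<in> carrier_mat n n" and AU: "A * U = U * D" and D: "D \<in> carrier_mat n n"
  shows "A = U * D * mat_adjoint U" 
proof -
  have Uc: "U \<in> carrier_mat n n" using U by (rule unitary_mat_carrier)
  have "U * D * mat_adjoint U = A * (U * mat_adjoint U)"
    using A Uc by (simp add: AU[symmetric] assoc_mult_mat[of _ n n _ n _ n])
  thus ?thesis using A by (simp add: unitary_mat_right[OF U])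
qed

lemma mtrace_unitary_conj:
  assumes U: "unitary_mat n U" and A: "A \<in> carrier_mat n n"
  shows "mtrace (mat_adjoint U * A * U) = mtrace A"
proof -
  have Uc: "U \<in> carrier_mat n n" using U by (rule unitary_mat_carrier)
  have "mtrace (mat_adjoint U * A * U) = mtrace (U * (mat_adjoint U * A))"
    using Uc A by (intro mtrace_mult_commute[of _ n n]) (auto intro!: mult_carrier_mat[of _ n n])
  also have "U * (mat_adjoint U * A) = (U * mat_adjoint U) * A"
    using Uc A by (simp add: assoc_mult_mat[of _ n n _ n _ n])
  finally show ?thesis using A by (simp add: unitary_mat_right[OF U])
qed

lemma mtrace_eigenvalues:
  assumes U: "unitary_mat n U" and A: "A \<in> carrier_mat n n" and AU: "A * U = U * mat_diag n f"
  shows "mtrace A = (\<Sum>i<n. f i)"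
proof -
  have Uc: "U \<in> carrier_mat n n" using U by (rule unitary_mat_carrier)
  have "mat_adjoint U * A * U = (mat_adjoint U * U) * mat_diag n f"
    using Uc A by (simp add: AU assoc_mult_mat[of _ n n _ n _ n])
  also have "\<dots> = mat_diag n f" using U left_mult_one_mat[OF mat_diag_dim] by (simp add: unitary_mat_def)
  finally show ?thesis using mtrace_unitary_conj[OF U A] by (simp add: mtrace_def)
qed

text \<open>The characteristic polynomial is invariant under similarity, and that of a diagonal
  matrix has the diagonal entries as roots, with multiplicity.\<close>

lemma vn_entropy_eigenvalues:
  assumes U: "unitary_mat n U" and A: "A \<in> carrier_mat n n"
    and AU: "A * U = U * mat_diag n (\<lambda>i. complex_of_real (p i))"
  shows "vn_entropy A = - (\<Sum>i<n. eta (p i))"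
proof -
  let ?D = "mat_diag n (\<lambda>i. complex_of_real (p i))"
  have Uc: "U \<in> carrier_mat n n" using U by (rule unitary_mat_carrier)
  have "similar_mat_wit A ?D U (mat_adjoint U)"
    using U unitary_mat_right[OF U] Uc A unitary_diag_eq[OF U A AU]
    by (intro similar_mat_witI[of _ _ n]) (auto simp: unitary_mat_def)
  hence "char_poly A = char_poly ?D"
    by (intro char_poly_similar) (auto simp: similar_mat_def)
  also have "\<dots> = (\<Prod>a\<leftarrow>diag_mat ?D. [:- a, 1:])"
    by (rule char_poly_upper_triangular[of _ n]) (auto simp: upper_triangular_def)
  also have "diag_mat ?D = map (\<lambda>i. complex_of_real (p i)) [0..<n]"
    by (auto simp: diag_mat_def intro!: nth_equalityI)
  finally have cp: "char_poly A = (\<Prod>a\<leftarrow>map (\<lambda>i. complex_of_real (p i)) [0..<n]. [:- a, 1:])" .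
  have pr: "proots (\<Prod>a\<leftarrow>as. [:- a, 1:]) = mset as" for as :: "complex list"
  proof (induction as)
    case (Cons a as)
    have "(\<Prod>a\<leftarrow>as. [:- a, 1:]) \<noteq> 0" by (auto simp: prod_list_zero_iff)
    thus ?case using Cons proots_mult[of "[:- a, 1:]" "\<Prod>a\<leftarrow>as. [:- a, 1:]"] by simp
  qed simp
  show ?thesis unfolding vn_entropy_def cp pr
    by (simp add: sum_mset_sum_list interv_sum_list_conv_sum_set_nat atLeast0LessThan comp_def flip: mset_map)
qed

subsection \<open>Kronecker powers\<close>

lemma sum_lessThan_mult:
  fixes f :: "nat \<Rightarrow> 'a::comm_monoid_add"
  shows "(\<Sum>x<a * b. f x) = (\<Sum>i<a. \<Sum>j<b. f (i * b + j))"
proof -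
  have "(\<Sum>x<a * b. f x) = (\<Sum>i<a. sum f {i * b..<i * b + b})"
    by (rule sum.nat_group[symmetric])
  also have "\<dots> = (\<Sum>i<a. \<Sum>j<b. f (i * b + j))"
  proof (rule sum.cong)
    fix i
    have "sum f {0 + i * b..<b + i * b} = (\<Sum>j\<in>{0..<b}. f (j + i * b))"
      by (rule sum.shift_bounds_nat_ivl)
    thus "sum f {i * b..<i * b + b} = (\<Sum>j<b. f (i * b + j))"
      by (simp add: atLeast0LessThan add.commute)
  qed simp
  finally show ?thesis .
qed

lemma mult_add_less: "i * b + j < a * b" if "i < a" "j < b" for i j a b :: nat
proof -
  have "i * b + j < Suc i * b" using that by simp
  also have "\<dots> \<le> a * b" using that by (intro mult_le_mono1) simp
  finally show ?thesis .
qed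

lemma div_mod_less_mult:
  fixes x a b :: nat
  assumes "x < a * b"
  shows "x div b < a" "x mod b < b"
  using assms by (auto simp: less_mult_imp_div_less intro!: mod_less_divisor gr0I)

lemma kron_carrier [simp]:
  "A \<in> carrier_mat n m \<Longrightarrow> B \<in> carrier_mat n' m' \<Longrightarrow> kron A B \<in> carrier_mat (n * n') (m * m')"
  by (auto simp: kron_def)

lemma kron_index:
  assumes "A \<in> carrier_mat n m" "B \<in> carrier_mat n' m'" "i < n * n'" "j < m * m'"
  shows "kron A B $$ (i, j) = A $$ (i div n', j div m') * B $$ (i mod n', j mod m')"
  using assms by (auto simp: kron_def)

lemma kron_mult:
  assumes A: "A \<in> carrier_mat n m" and B: "B \<in> carrier_mat n' m'"
    and C: "C \<in> carrier_mat m k" and D: "D \<in> carrier_mat m' k'"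
  shows "kron A B * kron C D = kron (A * C) (B * D)"
proof (rule eq_matI)
  have AC: "A * C \<in> carrier_mat n k" "B * D \<in> carrier_mat n' k'" using assms by auto
  fix i j assume "i < dim_row (kron (A * C) (B * D))" "j < dim_col (kron (A * C) (B * D))"
  hence ij: "i < n * n'" "j < k * k'" using A B C D by (auto simp: kron_def)
  note d = div_mod_less_mult[OF ij(1)] div_mod_less_mult[OF ij(2)]
  have "(kron A B * kron C D) $$ (i, j) = (\<Sum>x<m * m'. kron A B $$ (i, x) * kron C D $$ (x, j))"
    by (rule mat_mult_index) (use assms ij in auto)
  also have "\<dots> = (\<Sum>x<m. \<Sum>y<m'. kron A B $$ (i, x * m' + y) * kron C D $$ (x * m' + y, j))"
    by (rule sum_lessThan_mult)
  also have "\<dots> = (\<Sum>x<m. \<Sum>y<m'. (A $$ (i div n', x) * C $$ (x, j div k')) * (B $$ (i mod n', y) * D $$ (y, j mod k')))"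
    using ij mult_add_less by (intro sum.cong refl) (simp add: kron_index[OF A B] kron_index[OF C D])
  also have "\<dots> = (A * C) $$ (i div n', j div k') * (B * D) $$ (i mod n', j mod k')"
    by (simp add: mat_mult_index[OF A C] mat_mult_index[OF B D] d sum_product del: index_mult_mat)
  also have "\<dots> = kron (A * C) (B * D) $$ (i, j)"
    by (rule kron_index[symmetric, OF AC ij])
  finally show "(kron A B * kron C D) $$ (i, j) = kron (A * C) (B * D) $$ (i, j)" .
qed (use assms in \<open>auto simp: kron_def\<close>)

lemma kron_adjoint: "mat_adjoint (kron A B) = kron (mat_adjoint A) (mat_adjoint B)"
proof (rule eq_matI)
  fix i j assume "i < dim_row (kron (mat_adjoint A) (mat_adjoint B))" "j < dim_col (kron (mat_adjoint A) (mat_adjoint B))"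
  hence ij: "i < dim_col A * dim_col B" "j < dim_row A * dim_row B" by (auto simp: kron_def)
  thus "mat_adjoint (kron A B) $$ (i, j) = kron (mat_adjoint A) (mat_adjoint B) $$ (i, j)"
    using div_mod_less_mult[OF ij(1)] div_mod_less_mult[OF ij(2)] by (simp add: kron_def)
qed (auto simp: kron_def)

lemma kron_diag:
  "kron (mat_diag a f) (mat_diag b g) = mat_diag (a * b) (\<lambda>x. f (x div b) * g (x mod b))"
proof (rule eq_matI)
  fix i j assume "i < dim_row (mat_diag (a * b) (\<lambda>x. f (x div b) * g (x mod b)))"
    "j < dim_col (mat_diag (a * b) (\<lambda>x. f (x div b) * g (x mod b)))"
  hence ij: "i < a * b" "j < a * b" by auto
  have "i = j \<longleftrightarrow> i div b = j div b \<and> i mod b = j mod b"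
    by (metis div_mult_mod_eq)
  thus "kron (mat_diag a f) (mat_diag b g) $$ (i, j) = mat_diag (a * b) (\<lambda>x. f (x div b) * g (x mod b)) $$ (i, j)"
    using ij div_mod_less_mult[OF ij(1)] div_mod_less_mult[OF ij(2)] by (simp add: kron_def)
qed (auto simp: kron_def)

lemma mat_diag_one: "mat_diag n (\<lambda>_. 1) = 1\<^sub>m n"
  by (rule eq_matI) auto

lemma kron_one: "kron (1\<^sub>m a) (1\<^sub>m b) = 1\<^sub>m (a * b)"
  using kron_diag[of a "\<lambda>_. 1" b "\<lambda>_. 1"] by (simp add: mat_diag_one)

lemma unitary_mat_kron:
  assumes "unitary_mat n U" "unitary_mat m V"
  shows "unitary_mat (n * m) (kron U V)"
proof -
  have c: "U \<in> carrier_mat n n" "V \<in> carrier_mat m m" using assms by (auto simp: unitary_mat_def)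
  have "mat_adjoint (kron U V) * kron U V = kron (mat_adjoint U * U) (mat_adjoint V * V)"
    using c by (simp add: kron_adjoint kron_mult[of _ n n _ m m _ n _ m])
  thus ?thesis using assms c by (simp add: unitary_mat_def kron_one)
qed

lemma kron_pow_carrier: "A \<in> carrier_mat d d \<Longrightarrow> kron_pow A N \<in> carrier_mat (d ^ N) (d ^ N)"
  by (induction N) auto

lemma unitary_mat_kron_pow: "unitary_mat d U \<Longrightarrow> unitary_mat (d ^ N) (kron_pow U N)"
  by (induction N) (auto simp: unitary_mat_kron, simp add: unitary_mat_def)

text \<open>An index \<open>x < d ^ N\<close> encodes, by its base-\<open>d\<close> digits, an \<open>N\<close>-tuple of indices below \<open>d\<close>.\<close>

fun prod_weight :: "(nat \<Rightarrow> real) \<Rightarrow> nat \<Rightarrow> nat \<Rightarrow> nat \<Rightarrow> real" where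
  "prod_weight p d 0 x = 1"
| "prod_weight p d (Suc N) x = p (x div d ^ N) * prod_weight p d N (x mod d ^ N)"

text \<open>Parities add modulo 2 under tensor products: this is the parity of a product eigenvector
  whose factors have the parities given by \<open>g\<close>.\<close>

fun xor_grade :: "(nat \<Rightarrow> bool) \<Rightarrow> nat \<Rightarrow> nat \<Rightarrow> nat \<Rightarrow> bool" where
  "xor_grade g d 0 x = False"
| "xor_grade g d (Suc N) x = (g (x div d ^ N) \<noteq> xor_grade g d N (x mod d ^ N))"

text \<open>By the mixed product rule, tensor products of eigenvectors are eigenvectors and their
  eigenvalues multiply.\<close>

lemma kron_pow_eigenbasis:
  assumes A: "A \<in> carrier_mat d d" and U: "U \<in> carrier_mat d d"
    and AU: "A * U = U * mat_diag d (\<lambda>i. complex_of_real (p i))"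
  shows "kron_pow A N * kron_pow U N
      = kron_pow U N * mat_diag (d ^ N) (\<lambda>x. complex_of_real (prod_weight p d N x))"
proof (induction N)
  case 0
  show ?case by (rule eq_matI) auto
next
  case (Suc N)
  let ?n = "d ^ N"
  note c = kron_pow_carrier[OF A, of N] kron_pow_carrier[OF U, of N]
  have "kron_pow A (Suc N) * kron_pow U (Suc N) = kron (A * U) (kron_pow A N * kron_pow U N)"
    using A U c by (simp add: kron_mult[of _ d d _ ?n ?n _ d _ ?n])
  also have "\<dots> = kron_pow U (Suc N) * kron (mat_diag d (\<lambda>i. complex_of_real (p i))) (mat_diag ?n (\<lambda>x. complex_of_real (prod_weight p d N x)))"
    unfolding AU Suc.IH using U c by (simp add: kron_mult[of _ d d _ ?n ?n _ d _ ?n])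
  finally show ?case by (simp add: kron_diag)
qed

section \<open>Parity of concatenated occupation numbers\<close>

declare popcount.simps [simp del]

lemma popcount_append: "j < 2 ^ n \<Longrightarrow> popcount (i * 2 ^ n + j) = popcount i + popcount j"
proof (induction n arbitrary: j)
  case 0
  thus ?case by (simp add: popcount.simps[of 0])
next
  case (Suc n)
  have rec: "popcount m = m mod 2 + popcount (m div 2)" for m
    by (subst popcount.simps) (auto simp: popcount.simps[of 0])
  have "(i * 2 ^ Suc n + j) div 2 = i * 2 ^ n + j div 2" "(i * 2 ^ Suc n + j) mod 2 = j mod 2"
    by (auto simp: mult.assoc[symmetric] mod_add_left_eq[symmetric])
  moreover have "j div 2 < 2 ^ n" using Suc.prems by simp
  ultimately show ?case using Suc.IH[of "j div 2"] rec[of "i * 2 ^ Suc n + j"] rec[of j] by simp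
qed

lemma odd_occ_append: "j < 2 ^ n \<Longrightarrow> odd_occ (i * 2 ^ n + j) \<longleftrightarrow> odd_occ i \<noteq> odd_occ j"
  by (auto simp: odd_occ_def popcount_append)

lemma odd_occ_0 [simp]: "\<not> odd_occ 0"
  by (simp add: odd_occ_def popcount.simps)

text \<open>A base-\<open>2 ^ L\<close> digit is a block of \<open>L\<close> occupation numbers, so
  the parity of an index is the exclusive or of the parities of its digits, matching the recursion
  of \<open>xor_grade\<close>.\<close>

lemma kron_pow_graded:
  assumes U: "U \<in> carrier_mat (2 ^ L) (2 ^ L)"
    and g: "\<And>i j. i < 2 ^ L \<Longrightarrow> j < 2 ^ L \<Longrightarrow> U $$ (i, j) \<noteq> 0 \<Longrightarrow> odd_occ i = g j"
  shows "i < (2 ^ L) ^ N \<Longrightarrow> j < (2 ^ L) ^ N \<Longrightarrow> kron_pow U N $$ (i, j) \<noteq> 0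
    \<Longrightarrow> odd_occ i = xor_grade g (2 ^ L) N j"
proof (induction N arbitrary: i j)
  case (Suc N)
  let ?n = "(2 ^ L) ^ N"
  have ij: "i < 2 ^ L * ?n" "j < 2 ^ L * ?n" using Suc.prems by auto
  note d = div_mod_less_mult[OF ij(1)] div_mod_less_mult[OF ij(2)]
  have nz: "U $$ (i div ?n, j div ?n) \<noteq> 0" "kron_pow U N $$ (i mod ?n, j mod ?n) \<noteq> 0"
    using Suc.prems(3) by (auto simp: kron_index[OF U kron_pow_carrier[OF U] ij])
  have "odd_occ i = (odd_occ (i div ?n) \<noteq> odd_occ (i mod ?n))"
    using odd_occ_append[of "i mod ?n" "L * N" "i div ?n", unfolded power_mult div_mult_mod_eq] d(2) by blast
  thus ?case using g[OF d(1,3) nz(1)] Suc.IH[OF d(2,4) nz(2)] by simp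
qed simp

subsection \<open>Entanglement fidelity in closed form\<close>

text \<open>The expectation value of \<open>A\<close> in \<open>v\<close>; as an explicit double sum
  it can be rearranged entrywise.\<close>

definition braket :: "complex vec \<Rightarrow> complex mat \<Rightarrow> complex" where
  "braket v A = (\<Sum>i<dim_vec v. \<Sum>j<dim_vec v. cnj (v $ i) * A $$ (i, j) * v $ j)"

lemma braket_psd:
  assumes "psd n A" "v \<in> carrier_vec n"
  shows "Im (braket v A) = 0" "Re (braket v A) \<ge> 0"
proof -
  have "braket v A = (\<Sum>i<n. cnj (v $ i) * (\<Sum>k<n. A $$ (i, k) * v $ k))"
    using assms(2) by (simp add: braket_def sum_distrib_left mult.assoc)
  thus "Im (braket v A) = 0" "Re (braket v A) \<ge> 0"
    using psd_qform[OF assms(1), of "\<lambda>i. v $ i"] by simp_all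
qed

lemma psd_braketI:
  assumes A: "A \<in> carrier_mat n n"
    and "\<And>v. v \<in> carrier_vec n \<Longrightarrow> Im (braket v A) = 0 \<and> Re (braket v A) \<ge> 0"
  shows "psd n A"
proof -
  have "conjugate v \<bullet> (A *\<^sub>v v) = braket v A" if "v \<in> carrier_vec n" for v
    using that by (simp add: qform_sum[OF A that] braket_def sum_distrib_left mult.assoc)
  thus ?thesis using assms by (simp add: psd_def)
qed

lemma braket_add:
  assumes "A \<in> carrier_mat n n" "B \<in> carrier_mat n n" "v \<in> carrier_vec n"
  shows "braket v (A + B) = braket v A + braket v B"
  using assms by (simp add: braket_def algebra_simps sum.distrib)

lemma outer_carrier [simp]: "v \<in> carrier_vec n \<Longrightarrow> outer v \<in> carrier_mat n n"
  by (auto simp: outer_def)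

lemma outer_dim [simp]: "dim_row (outer v) = dim_vec v" "dim_col (outer v) = dim_vec v"
  by (auto simp: outer_def)

lemma outer_index [simp]:
  "i < dim_vec v \<Longrightarrow> j < dim_vec v \<Longrightarrow> outer v $$ (i, j) = v $ i * cnj (v $ j)"
  by (simp add: outer_def)

lemma mat_adjoint_outer: "mat_adjoint (outer v) = outer v"
  by (rule eq_matI) (auto simp: outer_def)

text \<open>For a pure first argument, the matrix under the outer square root in the fidelity is
  thereby a multiple of a rank-one projector.\<close>

lemma outer_sandwich:
  assumes A: "A \<in> carrier_mat n n" and v: "v \<in> carrier_vec n"
  shows "outer v * A * outer v = braket v A \<cdot>\<^sub>m outer v"
proof (rule eq_matI)
  note P = outer_carrier[OF v]
  fix i j assume "i < dim_row (braket v A \<cdot>\<^sub>m outer v)" "j < dim_col (braket v A \<cdot>\<^sub>m outer v)"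
  hence ij: "i < n" "j < n" using P by auto
  have "(outer v * A * outer v) $$ (i, j) = (\<Sum>l<n. (\<Sum>k<n. outer v $$ (i, k) * A $$ (k, l)) * outer v $$ (l, j))"
    by (subst mat_mult_index[of _ n n _ n])
      (use P A ij in \<open>auto simp: mat_mult_index[OF P A] simp del: index_mult_mat(1) intro!: sum.cong\<close>)
  also have "\<dots> = (\<Sum>k<n. \<Sum>l<n. outer v $$ (i, k) * A $$ (k, l) * outer v $$ (l, j))"
    by (subst sum.swap) (simp add: sum_distrib_right)
  also have "\<dots> = (braket v A \<cdot>\<^sub>m outer v) $$ (i, j)"
    using v ij P by (simp add: braket_def sum_distrib_left mult_ac)
  finally show "(outer v * A * outer v) $$ (i, j) = (braket v A \<cdot>\<^sub>m outer v) $$ (i, j)" .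
qed (use v in auto)

lemma unit_vec_sum:
  assumes "v \<in> carrier_vec n"
  shows "conjugate v \<bullet> v = (\<Sum>i<n. v $ i * cnj (v $ i))"
  using assms by (auto simp: scalar_prod_def atLeast0LessThan mult.commute intro!: sum.cong)

lemma outer_idem:
  assumes v: "v \<in> carrier_vec n" and u: "conjugate v \<bullet> v = 1"
  shows "outer v * outer v = outer v" "mtrace (outer v) = 1"
proof -
  show tr: "mtrace (outer v) = 1"
    using u v unfolding unit_vec_sum[OF v] by (simp add: mtrace_def outer_def)
  have "braket v (1\<^sub>m n) = (\<Sum>i<n. \<Sum>j<n. if j = i then v $ i * cnj (v $ i) else 0)"
    unfolding braket_def using v by (intro sum.cong) auto
  also have "\<dots> = 1" using u unfolding unit_vec_sum[OF v] by simp
  finally have b1: "braket v (1\<^sub>m n) = 1" .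
  have "1 \<cdot>\<^sub>m outer v = outer v" by (rule eq_matI) auto
  thus "outer v * outer v = outer v"
    using outer_sandwich[OF one_carrier_mat v] right_mult_one_mat[OF outer_carrier[OF v]] b1 by simp
qed

text \<open>The diagonal of the product lists the squared norms of the columns of
  \<open>X\<close>.\<close>

lemma adjoint_mult_self_zero:
  fixes X :: "complex mat"
  assumes X: "X \<in> carrier_mat n m" and 0: "mat_adjoint X * X = 0\<^sub>m m m"
  shows "X = 0\<^sub>m n m"
proof (rule eq_matI)
  fix i j assume "i < dim_row (0\<^sub>m n m :: complex mat)" "j < dim_col (0\<^sub>m n m :: complex mat)"
  hence ij: "i < n" "j < m" by auto
  have "complex_of_real (\<Sum>k<n. (cmod (X $$ (k, j)))\<^sup>2) = (\<Sum>k<n. cnj (X $$ (k, j)) * X $$ (k, j))"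
    unfolding of_real_sum by (intro sum.cong refl) (simp only: complex_norm_square mult.commute)
  also have "\<dots> = (mat_adjoint X * X) $$ (j, j)"
    using X ij by (subst mat_mult_index[of _ m n _ m]) auto
  also have "\<dots> = 0" using 0 ij by simp
  finally have "(\<Sum>k<n. (cmod (X $$ (k, j)))\<^sup>2) = 0" using of_real_eq_0_iff by blast
  hence "X $$ (i, j) = 0" using ij by (subst (asm) sum_nonneg_eq_0_iff) auto
  thus "X $$ (i, j) = 0\<^sub>m n m $$ (i, j)" using ij by simp
qed (use X in auto)

text \<open>\<open>psd_sqrt\<close> is a definite description, so uniqueness has to be shown too. A
  positive root \<open>B\<close> kills the orthogonal complement of \<open>v\<close>, hence is a
  multiple of the projector onto \<open>v\<close>, and the trace fixes the factor.\<close>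

lemma psd_sqrt_outer:
  assumes v: "v \<in> carrier_vec n" and u: "conjugate v \<bullet> v = 1" and c: "c \<ge> 0"
  shows "psd_sqrt (complex_of_real c \<cdot>\<^sub>m outer v) = complex_of_real (sqrt c) \<cdot>\<^sub>m outer v"
  unfolding psd_sqrt_def
proof (rule the_equality)
  let ?P = "outer v"
  note P = outer_carrier[OF v] and PP = outer_idem(1)[OF v u] and trP = outer_idem(2)[OF v u]
  note [simp] = assoc_mult_mat[of _ n n _ n _ n] mult_carrier_mat[of _ n n _ n]
  have sq: "(a \<cdot>\<^sub>m ?P) * (b \<cdot>\<^sub>m ?P) = (a * b) \<cdot>\<^sub>m ?P" for a b
  proof -
    have "(a \<cdot>\<^sub>m ?P) * (b \<cdot>\<^sub>m ?P) = b \<cdot>\<^sub>m (a \<cdot>\<^sub>m ?P)"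
      using P by (simp add: mult_smult_assoc_mat[of _ n n _ n] mult_smult_distrib[of _ n n _ n] PP)
    also have "\<dots> = (a * b) \<cdot>\<^sub>m ?P" by (rule eq_matI) auto
    finally show ?thesis .
  qed
  have d: "dim_row (complex_of_real c \<cdot>\<^sub>m ?P) = n" using v by simp
  have "psd n (complex_of_real (sqrt c) \<cdot>\<^sub>m ?P)"
  proof (rule psd_braketI)
    fix w :: "complex vec" assume w: "w \<in> carrier_vec n"
    have "braket w (complex_of_real (sqrt c) \<cdot>\<^sub>m ?P)
        = (\<Sum>i<n. \<Sum>j<n. of_real (sqrt c) * ((cnj (w $ i) * v $ i) * cnj (cnj (w $ j) * v $ j)))"
      using v w P by (simp add: braket_def mult_ac)
    also have "\<dots> = of_real (sqrt c) * ((\<Sum>i<n. cnj (w $ i) * v $ i) * cnj (\<Sum>i<n. cnj (w $ i) * v $ i))"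
      unfolding cnj_sum sum_product by (simp add: sum_distrib_left)
    also have "\<dots> = of_real (sqrt c * (cmod (\<Sum>i<n. cnj (w $ i) * v $ i))\<^sup>2)"
      by (simp only: complex_norm_square of_real_mult)
    finally show "Im (braket w (complex_of_real (sqrt c) \<cdot>\<^sub>m ?P)) = 0 \<and> Re (braket w (complex_of_real (sqrt c) \<cdot>\<^sub>m ?P)) \<ge> 0"
      using c by simp
  qed (use P in simp)
  moreover have "(complex_of_real (sqrt c) \<cdot>\<^sub>m ?P) * (complex_of_real (sqrt c) \<cdot>\<^sub>m ?P) = complex_of_real c \<cdot>\<^sub>m ?P"
    using c by (simp add: sq flip: of_real_mult)
  ultimately show "psd (dim_row (complex_of_real c \<cdot>\<^sub>m ?P)) (complex_of_real (sqrt c) \<cdot>\<^sub>m ?P) \<and>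
      (complex_of_real (sqrt c) \<cdot>\<^sub>m ?P) * (complex_of_real (sqrt c) \<cdot>\<^sub>m ?P) = complex_of_real c \<cdot>\<^sub>m ?P"
    unfolding d by blast
  fix B assume "psd (dim_row (complex_of_real c \<cdot>\<^sub>m ?P)) B \<and> B * B = complex_of_real c \<cdot>\<^sub>m ?P"
  hence psd: "psd n B" and BB: "B * B = complex_of_real c \<cdot>\<^sub>m ?P" unfolding d by auto
  have B: "B \<in> carrier_mat n n" using psd by (simp add: psd_def)
  have Bh: "mat_adjoint B = B" by (rule psd_hermitian[OF psd])
  \<comment> \<open>The projector onto the complement of \<open>v\<close>: since \<open>B\<close>
    squares to a multiple of \<open>outer v\<close>, \<open>B * Q\<close> times its adjoint on the
    left is 0, so \<open>B * Q\<close> itself vanishes.\<close>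
  define Q where "Q = 1\<^sub>m n - ?P"
  have Q: "Q \<in> carrier_mat n n" unfolding Q_def by (rule minus_carrier_mat[OF P])
  have PQ: "?P * Q = 0\<^sub>m n n"
    unfolding Q_def using P by (simp add: mult_minus_distrib_mat[of _ n n _ n] right_mult_one_mat[OF P] PP)
  have "mat_adjoint (B * Q) * (B * Q) = mat_adjoint Q * ((B * B) * Q)"
    using B Q by (simp add: mat_adjoint_mult[of _ n n _ n] Bh)
  also have "(B * B) * Q = 0\<^sub>m n n"
    unfolding BB using P Q PQ by (simp add: mult_smult_assoc_mat[of _ n n _ n])
  finally have "mat_adjoint (B * Q) * (B * Q) = 0\<^sub>m n n" using Q by simp
  hence "B * Q = 0\<^sub>m n n" by (rule adjoint_mult_self_zero[OF mult_carrier_mat[OF B Q]])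
  hence "B - B * ?P = 0\<^sub>m n n"
    unfolding Q_def using B P by (simp add: mult_minus_distrib_mat[of _ n n _ n] right_mult_one_mat[OF B])
  note BQ = this
  have BP: "B = B * ?P"
  proof (rule eq_matI)
    fix i j assume "i < dim_row (B * ?P)" "j < dim_col (B * ?P)"
    hence ij: "i < n" "j < n" using B v by auto
    have "(B - B * ?P) $$ (i, j) = 0" unfolding BQ using ij by simp
    thus "B $$ (i, j) = (B * ?P) $$ (i, j)" using ij B v by (simp del: index_mult_mat(1))
  qed (use B v in auto)
  hence "mat_adjoint B = mat_adjoint (B * ?P)" by simp
  hence PB: "B = ?P * B" using B P by (simp add: mat_adjoint_mult[of _ n n _ n] Bh mat_adjoint_outer)
  have "B = ?P * B * ?P" using BP PB by simp
  also have "\<dots> = braket v B \<cdot>\<^sub>m ?P" by (rule outer_sandwich[OF B v])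
  also have "braket v B = of_real (Re (braket v B))"
    using braket_psd[OF psd v] by (simp add: complex_eq_iff)
  finally obtain b where b: "B = complex_of_real b \<cdot>\<^sub>m ?P" "b \<ge> 0"
    using braket_psd[OF psd v] by blast
  have "complex_of_real c \<cdot>\<^sub>m ?P = complex_of_real (b * b) \<cdot>\<^sub>m ?P"
    unfolding BB[symmetric] b(1)
    by (simp add: sq)
  moreover have "mtrace (complex_of_real a \<cdot>\<^sub>m ?P) = complex_of_real a" for a
    using trP by (simp add: mtrace_def sum_distrib_left[symmetric] outer_def)
  ultimately have "complex_of_real c = complex_of_real (b * b)" by metis
  hence "c = b * b" using of_real_eq_iff by blast
  thus "B = complex_of_real (sqrt c) \<cdot>\<^sub>m ?P" using b by simp
qed

text \<open>A projector is its own square root, so the fidelity is the trace of the root of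
  \<open>c\<close> times that projector, namely \<open>sqrt c\<close>.\<close>

lemma fidelity_outer:
  assumes v: "v \<in> carrier_vec n" and u: "conjugate v \<bullet> v = 1"
    and \<sigma>: "\<sigma> \<in> carrier_mat n n" and c: "braket v \<sigma> = complex_of_real c" "c \<ge> 0"
  shows "(fidelity (outer v) \<sigma>)\<^sup>2 = c"
proof -
  have "psd_sqrt (complex_of_real 1 \<cdot>\<^sub>m outer v) = complex_of_real (sqrt 1) \<cdot>\<^sub>m outer v"
    by (rule psd_sqrt_outer[OF v u]) simp
  moreover have "complex_of_real 1 \<cdot>\<^sub>m outer v = outer v" by (rule eq_matI) auto
  ultimately have "psd_sqrt (outer v) = outer v" by simp
  moreover have "mtrace (complex_of_real a \<cdot>\<^sub>m outer v) = complex_of_real a" for a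
    using outer_idem(2)[OF v u] by (simp add: mtrace_def sum_distrib_left[symmetric] outer_def)
  ultimately show ?thesis
    unfolding fidelity_def using c by (simp add: outer_sandwich[OF \<sigma> v] psd_sqrt_outer[OF v u c(2)])
qed

section \<open>Kraus sums and purifications\<close>

lemma msum_Nil [simp]: "msum d [] = 0\<^sub>m d d" and msum_Cons [simp]: "msum d (x # xs) = x + msum d xs"
  by (auto simp: msum_def)

lemma msum_carrier: "(\<And>x. x \<in> set xs \<Longrightarrow> x \<in> carrier_mat d d) \<Longrightarrow> msum d xs \<in> carrier_mat d d"
  by (induction xs) auto

lemma msum_index:
  "(\<And>x. x \<in> set xs \<Longrightarrow> x \<in> carrier_mat d d) \<Longrightarrow> i < d \<Longrightarrow> j < d
    \<Longrightarrow> msum d xs $$ (i, j) = (\<Sum>x\<leftarrow>xs. x $$ (i, j))"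
proof (induction xs)
  case (Cons x xs)
  have "msum d xs \<in> carrier_mat d d" using Cons.prems(1) by (intro msum_carrier) auto
  thus ?case using Cons by auto
qed simp

lemma braket_msum:
  assumes v: "v \<in> carrier_vec d"
  shows "(\<And>x. x \<in> set xs \<Longrightarrow> x \<in> carrier_mat d d) \<Longrightarrow> braket v (msum d xs) = (\<Sum>x\<leftarrow>xs. braket v x)"
proof (induction xs)
  case Nil
  show ?case using v by (simp add: braket_def)
next
  case (Cons x xs)
  have "msum d xs \<in> carrier_mat d d" using Cons.prems(1) by (intro msum_carrier) auto
  thus ?case using Cons braket_add[of x d "msum d xs" v] v by auto
qed

lemma braket_conj_outer:
  assumes v: "v \<in> carrier_vec n" and K: "K \<in> carrier_mat n n"
  shows "braket v (K * outer v * mat_adjoint K) = of_real ((cmod (braket v K))\<^sup>2)"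
proof -
  note P = outer_carrier[OF v]
  have KP: "(K * outer v) $$ (i, j) = (\<Sum>l<n. K $$ (i, l) * v $ l) * cnj (v $ j)" if "i < n" "j < n" for i j
    unfolding mat_mult_index[OF K P that] sum_distrib_right using v that by (intro sum.cong) auto
  have KPK: "(K * outer v * mat_adjoint K) $$ (i, j)
      = (\<Sum>l<n. K $$ (i, l) * v $ l) * cnj (\<Sum>l<n. K $$ (j, l) * v $ l)" if "i < n" "j < n" for i j
  proof -
    have "(K * outer v * mat_adjoint K) $$ (i, j) = (\<Sum>l<n. (K * outer v) $$ (i, l) * cnj (K $$ (j, l)))"
      using K P that by (subst mat_mult_index[of _ n n _ n]) (auto simp del: index_mult_mat(1) intro!: sum.cong)
    also have "\<dots> = (\<Sum>l<n. (\<Sum>l<n. K $$ (i, l) * v $ l) * cnj (K $$ (j, l) * v $ l))"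
      using that by (intro sum.cong) (auto simp: KP simp del: index_mult_mat(1))
    finally show ?thesis by (simp add: sum_distrib_left)
  qed
  have b: "braket v K = (\<Sum>i<n. cnj (v $ i) * (\<Sum>l<n. K $$ (i, l) * v $ l))"
    using v by (simp add: braket_def sum_distrib_left mult.assoc)
  have "braket v (K * outer v * mat_adjoint K)
      = (\<Sum>i<n. \<Sum>j<n. (cnj (v $ i) * (\<Sum>l<n. K $$ (i, l) * v $ l)) * cnj (cnj (v $ j) * (\<Sum>l<n. K $$ (j, l) * v $ l)))"
    unfolding braket_def using v by (intro sum.cong) (auto simp: KPK mult_ac simp del: index_mult_mat(1))
  also have "\<dots> = braket v K * cnj (braket v K)"
    unfolding b cnj_sum sum_product ..
  finally show ?thesis by (simp only: complex_norm_square)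
qed

text \<open>An operator acting trivially on the ancilla sees only the reduced state. This is where
  dependence on the purification disappears.\<close>

lemma braket_kron_one:
  assumes v: "v \<in> carrier_vec (2 ^ (n + k))" and C: "C \<in> carrier_mat (2 ^ n) (2 ^ n)"
    and pt: "ptrace_last n k (outer v) = \<rho>"
  shows "braket v (kron C (1\<^sub>m (2 ^ k))) = mtrace (C * \<rho>)"
proof -
  let ?n = "2 ^ n :: nat" and ?k = "2 ^ k :: nat"
  have \<rho>: "\<rho> \<in> carrier_mat ?n ?n" unfolding pt[symmetric] ptrace_last_def by simp
  have less: "i * ?k + a < 2 ^ (n + k)" if "i < ?n" "a < ?k" for i a
    using mult_add_less[OF that] by (simp add: power_add)
  have \<rho>i: "\<rho> $$ (j, i) = (\<Sum>a<?k. v $ (j * ?k + a) * cnj (v $ (i * ?k + a)))" if "i < ?n" "j < ?n" for i j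
    unfolding pt[symmetric] ptrace_last_def using that v less by (simp add: outer_def)
  have "braket v (kron C (1\<^sub>m ?k)) = (\<Sum>i<?n. \<Sum>a<?k. \<Sum>j<?n. \<Sum>b<?k.
      cnj (v $ (i * ?k + a)) * kron C (1\<^sub>m ?k) $$ (i * ?k + a, j * ?k + b) * v $ (j * ?k + b))"
    using v by (simp add: braket_def power_add sum_lessThan_mult)
  also have "\<dots> = (\<Sum>i<?n. \<Sum>a<?k. \<Sum>j<?n. \<Sum>b<?k.
      if b = a then cnj (v $ (i * ?k + a)) * C $$ (i, j) * v $ (j * ?k + a) else 0)"
    using mult_add_less by (intro sum.cong refl) (simp add: kron_index[OF C one_carrier_mat])
  also have "\<dots> = (\<Sum>i<?n. \<Sum>a<?k. \<Sum>j<?n. cnj (v $ (i * ?k + a)) * C $$ (i, j) * v $ (j * ?k + a))"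
    by (intro sum.cong refl) simp
  also have "\<dots> = (\<Sum>i<?n. \<Sum>j<?n. C $$ (i, j) * \<rho> $$ (j, i))"
    by (rule sum.cong[OF refl], subst sum.swap) (simp add: \<rho>i sum_distrib_left mult_ac)
  also have "\<dots> = mtrace (C * \<rho>)"
    using C by (simp add: mtrace_def mat_mult_index[OF C \<rho>] del: index_mult_mat(1))
  finally show ?thesis .
qed

lemma purification_fidelity:
  assumes pur: "purification n k \<rho> v" and Cs: "Cs \<noteq> []" "\<And>C. C \<in> set Cs \<Longrightarrow> C \<in> carrier_mat (2 ^ n) (2 ^ n)"
  shows "(fidelity (outer v) (apply_channel (extend_channel k Cs) (outer v)))\<^sup>2
    = (\<Sum>C\<leftarrow>Cs. (cmod (mtrace (C * \<rho>)))\<^sup>2)"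
proof -
  let ?d = "2 ^ (n + k) :: nat"
  have v: "v \<in> carrier_vec ?d" and u: "conjugate v \<bullet> v = 1" and pt: "ptrace_last n k (outer v) = \<rho>"
    using pur by (auto simp: purification_def pure_ferm_vec_def)
  let ?Ks = "extend_channel k Cs"
  let ?f = "\<lambda>K. K * outer v * mat_adjoint K"
  have K: "K \<in> carrier_mat ?d ?d" if "K \<in> set ?Ks" for K
    using that Cs(2) kron_carrier[of _ "2 ^ n" "2 ^ n" "1\<^sub>m (2 ^ k)" "2 ^ k" "2 ^ k"]
    by (auto simp: extend_channel_def power_add)
  have f: "?f K \<in> carrier_mat ?d ?d" if "K \<in> set ?Ks" for K
    using K[OF that] outer_carrier[OF v] by (intro mult_carrier_mat[of _ ?d ?d]) auto
  have ne: "?Ks \<noteq> []" using Cs(1) by (simp add: extend_channel_def)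
  have \<sigma>: "apply_channel ?Ks (outer v) = msum ?d (map ?f ?Ks)"
    using K[OF hd_in_set[OF ne]] by (simp add: apply_channel_def)
  have "braket v (apply_channel ?Ks (outer v)) = (\<Sum>x\<leftarrow>map ?f ?Ks. braket v x)"
    unfolding \<sigma> by (rule braket_msum[OF v]) (use f in auto)
  also have "\<dots> = (\<Sum>K\<leftarrow>?Ks. complex_of_real ((cmod (braket v K))\<^sup>2))"
    unfolding map_map comp_def
    by (intro arg_cong[of _ _ sum_list] map_cong refl braket_conj_outer[OF v K])
  also have "\<dots> = (\<Sum>C\<leftarrow>Cs. complex_of_real ((cmod (mtrace (C * \<rho>)))\<^sup>2))"
    unfolding extend_channel_def map_map comp_def
    by (intro arg_cong[of _ _ sum_list] map_cong refl) (use braket_kron_one[OF v Cs(2) pt] in simp)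
  also have "\<dots> = complex_of_real (\<Sum>C\<leftarrow>Cs. (cmod (mtrace (C * \<rho>)))\<^sup>2)"
    by (induction Cs) auto
  finally have "braket v (apply_channel ?Ks (outer v)) = complex_of_real (\<Sum>C\<leftarrow>Cs. (cmod (mtrace (C * \<rho>)))\<^sup>2)" .
  moreover have "apply_channel ?Ks (outer v) \<in> carrier_mat ?d ?d"
    unfolding \<sigma> by (rule msum_carrier) (use f in auto)
  moreover have "(\<Sum>C\<leftarrow>Cs. (cmod (mtrace (C * \<rho>)))\<^sup>2) \<ge> 0"
    by (rule sum_list_nonneg) auto
  ultimately show ?thesis by (intro fidelity_outer[OF v u])
qed

lemma purification_exists:
  assumes W: "unitary_mat (2 ^ n) W" and \<rho>: "\<rho> \<in> carrier_mat (2 ^ n) (2 ^ n)"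
    and RW: "\<rho> * W = W * mat_diag (2 ^ n) (\<lambda>x. complex_of_real (q x))"
    and q: "\<And>x. x < 2 ^ n \<Longrightarrow> q x \<ge> 0" "(\<Sum>x<2 ^ n. q x) = 1"
    and g: "\<And>i j. i < 2 ^ n \<Longrightarrow> j < 2 ^ n \<Longrightarrow> W $$ (i, j) \<noteq> 0 \<Longrightarrow> odd_occ i = g j"
  shows "\<exists>v. purification n n \<rho> v"
proof -
  let ?d = "2 ^ n :: nat"
  have Wc: "W \<in> carrier_mat ?d ?d" using W by (rule unitary_mat_carrier)
  note [simp] = assoc_mult_mat[of _ ?d ?d _ ?d _ ?d] mult_carrier_mat[of _ ?d ?d _ ?d]
  define R where "R = mat_diag ?d (\<lambda>x. complex_of_real (sqrt (q x)))"
  have Rc: "R \<in> carrier_mat ?d ?d" by (simp add: R_def)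
  have Rh: "mat_adjoint R = R" by (rule eq_matI) (auto simp: R_def)
  have RR: "R * R = mat_diag ?d (\<lambda>x. complex_of_real (q x))"
    unfolding R_def mat_diag_diag by (rule eq_matI) (use q(1) in \<open>auto simp flip: of_real_mult\<close>)
  \<comment> \<open>The positive square root of \<rho>. Read as a vector with the column index on
    the ancilla, its partial trace is \<open>S * mat_adjoint S\<close>, that is \<rho>, and its
    squared norm is the trace of \<rho>.\<close>
  define S where "S = W * R * mat_adjoint W"
  have Sc: "S \<in> carrier_mat ?d ?d" using Wc Rc by (simp add: S_def)
  have Sh: "mat_adjoint S = S"
    using Wc Rc by (simp add: S_def mat_adjoint_mult[of _ ?d ?d _ ?d] Rh)
  have SS: "S * mat_adjoint S = \<rho>"
  proof -
    have "S * S = W * (R * ((mat_adjoint W * W) * (R * mat_adjoint W)))"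
      unfolding S_def using Wc Rc by simp
    also have "\<dots> = W * (R * R) * mat_adjoint W"
      using W Wc Rc by (simp add: unitary_mat_def)
    also have "\<dots> = \<rho>" unfolding RR by (rule unitary_diag_eq[OF W \<rho> RW, symmetric]) simp
    finally show ?thesis unfolding Sh .
  qed
  \<comment> \<open>Each term of the entry passes through one eigenvector \<open>x\<close>, which
    forces both indices to have parity \<open>g x\<close>. Hence the vectorised \<open>S\<close> is
    supported on even total occupation.\<close>
  have Sg: "odd_occ i = odd_occ j" if ij: "i < ?d" "j < ?d" and nz: "S $$ (i, j) \<noteq> 0" for i j
  proof -
    have "S $$ (i, j) = (\<Sum>x<?d. (W * R) $$ (i, x) * cnj (W $$ (j, x)))"
      unfolding S_def using ij Wc Rc
      by (subst mat_mult_index[of _ ?d ?d _ ?d]) (auto simp del: index_mult_mat(1) intro!: sum.cong)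
    also have "\<dots> = (\<Sum>x<?d. W $$ (i, x) * of_real (sqrt (q x)) * cnj (W $$ (j, x)))"
      using ij Wc by (intro sum.cong refl) (simp add: R_def mat_diag_mult_right[OF Wc])
    finally obtain x where x: "x < ?d" "W $$ (i, x) * of_real (sqrt (q x)) * cnj (W $$ (j, x)) \<noteq> 0"
      using nz by (metis (no_types, lifting) lessThan_iff sum.neutral)
    thus ?thesis using g[of i x] g[of j x] ij by auto
  qed
  define v where "v = vec (2 ^ (n + n)) (\<lambda>x. S $$ (x div ?d, x mod ?d))"
  have v: "v \<in> carrier_vec (2 ^ (n + n))" by (simp add: v_def)
  have vi: "v $ (i * ?d + a) = S $$ (i, a)" if "i < ?d" "a < ?d" for i a
    using mult_add_less[OF that] that by (simp add: v_def power_add)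
  have \<rho>i: "(\<Sum>a<?d. S $$ (i, a) * cnj (S $$ (j, a))) = \<rho> $$ (i, j)" if "i < ?d" "j < ?d" for i j
    unfolding SS[symmetric] using that Sc by (subst mat_mult_index[of _ ?d ?d _ ?d]) auto
  have "ptrace_last n n (outer v) = \<rho>"
  proof (rule eq_matI)
    fix i j assume "i < dim_row \<rho>" "j < dim_col \<rho>"
    hence ij: "i < ?d" "j < ?d" using \<rho> by auto
    have "ptrace_last n n (outer v) $$ (i, j) = (\<Sum>a<?d. v $ (i * ?d + a) * cnj (v $ (j * ?d + a)))"
      using ij v mult_add_less by (simp add: ptrace_last_def outer_def power_add)
    thus "ptrace_last n n (outer v) $$ (i, j) = \<rho> $$ (i, j)" using ij vi \<rho>i[OF ij] by simp
  qed (use \<rho> in \<open>auto simp: ptrace_last_def\<close>)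
  moreover have "conjugate v \<bullet> v = 1"
  proof -
    have "conjugate v \<bullet> v = (\<Sum>i<?d. \<Sum>a<?d. v $ (i * ?d + a) * cnj (v $ (i * ?d + a)))"
      unfolding unit_vec_sum[OF v] by (simp add: power_add sum_lessThan_mult)
    also have "\<dots> = mtrace \<rho>" using vi \<rho>i \<rho> by (simp add: mtrace_def)
    also have "\<dots> = 1" using mtrace_eigenvalues[OF W \<rho> RW] q(2) by (simp flip: of_real_sum)
    finally show ?thesis .
  qed
  moreover have "v $ x = 0" if x: "x < 2 ^ (n + n)" "odd_occ x" for x
  proof -
    have x': "x < ?d * ?d" using x by (simp add: power_add)
    note d = div_mod_less_mult[OF x']
    have "odd_occ x \<longleftrightarrow> odd_occ (x div ?d) \<noteq> odd_occ (x mod ?d)"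
      using odd_occ_append[of "x mod ?d" n "x div ?d", unfolded div_mult_mod_eq] d(2) by blast
    thus ?thesis using Sg[of "x div ?d" "x mod ?d"] d x by (auto simp: v_def)
  qed
  ultimately show ?thesis using v by (auto simp: purification_def pure_ferm_vec_def)
qed

text \<open>All purifications give the same value and one exists, so the choice in
  \<open>ent_fidelity\<close> is determined.\<close>

theorem ent_fidelity_eq:
  assumes "unitary_mat (2 ^ n) W" "\<rho> \<in> carrier_mat (2 ^ n) (2 ^ n)"
    "\<rho> * W = W * mat_diag (2 ^ n) (\<lambda>x. complex_of_real (q x))"
    "\<And>x. x < 2 ^ n \<Longrightarrow> q x \<ge> 0" "(\<Sum>x<2 ^ n. q x) = 1"
    "\<And>i j. i < 2 ^ n \<Longrightarrow> j < 2 ^ n \<Longrightarrow> W $$ (i, j) \<noteq> 0 \<Longrightarrow> odd_occ i = g j"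
    and Cs: "Cs \<noteq> []" "\<And>C. C \<in> set Cs \<Longrightarrow> C \<in> carrier_mat (2 ^ n) (2 ^ n)"
  shows "ent_fidelity n \<rho> Cs = (\<Sum>C\<leftarrow>Cs. (cmod (mtrace (C * \<rho>)))\<^sup>2)"
proof -
  obtain v where "purification n n \<rho> v" using purification_exists[of n W \<rho> q g] assms(1-6) by blast
  thus ?thesis unfolding ent_fidelity_def
    using purification_fidelity[OF _ Cs] by (intro some_equality) (metis, auto)
qed

lemma mtrace_mult_eigenbasis:
  assumes W: "unitary_mat n W" and \<rho>: "\<rho> \<in> carrier_mat n n"
    and RW: "\<rho> * W = W * mat_diag n f" and C: "C \<in> carrier_mat n n"
  shows "mtrace (C * \<rho>) = (\<Sum>x<n. f x * (mat_adjoint W * C * W) $$ (x, x))"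
proof -
  have Wc: "W \<in> carrier_mat n n" using W by (rule unitary_mat_carrier)
  note [simp] = assoc_mult_mat[of _ n n _ n _ n] mult_carrier_mat[of _ n n _ n]
  have "mtrace (C * \<rho>) = mtrace (mat_adjoint W * (C * \<rho>) * W)"
    by (rule mtrace_unitary_conj[OF W, symmetric]) (use C \<rho> in simp)
  also have "mat_adjoint W * (C * \<rho>) * W = mat_adjoint W * (C * (\<rho> * W))"
    using Wc C \<rho> by simp
  also have "\<dots> = (mat_adjoint W * C * W) * mat_diag n f"
    unfolding RW using Wc C by simp
  also have "\<dots> = mat n n (\<lambda>(i, j). (mat_adjoint W * C * W) $$ (i, j) * f j)"
    by (rule mat_diag_mult_right) (use Wc C in simp)
  also have "mtrace \<dots> = (\<Sum>x<n. f x * (mat_adjoint W * C * W) $$ (x, x))"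
    unfolding mtrace_def by (simp add: mult.commute del: index_mult_mat)
  finally show ?thesis .
qed

subsection \<open>Typical product weights\<close>

text \<open>Information content in bits. The convention at 0 matches that of \<open>eta\<close>, so
  that its mean is the entropy.\<close>

definition surprisal :: "real \<Rightarrow> real" where
  "surprisal t = (if t = 0 then 0 else - log 2 t)"

fun digit_sum :: "(nat \<Rightarrow> real) \<Rightarrow> nat \<Rightarrow> nat \<Rightarrow> nat \<Rightarrow> real" where
  "digit_sum f d 0 x = 0"
| "digit_sum f d (Suc N) x = f (x div d ^ N) + digit_sum f d N (x mod d ^ N)"

lemma div_mod_append: "(i * n + y) div n = i" "(i * n + y) mod n = y" if "y < n" for i n y :: nat
  using that by auto

section \<open>Law of large numbers for \<open>N\<close> independent digits distributed according to
  \<open>p\<close>\<close>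

context
  fixes p :: "nat \<Rightarrow> real" and d :: nat
  assumes p_nonneg: "\<And>i. i < d \<Longrightarrow> p i \<ge> 0" and p_sum: "(\<Sum>i<d. p i) = 1"
begin

lemma prod_weight_append:
  "y < d ^ N \<Longrightarrow> prod_weight p d (Suc N) (i * d ^ N + y) = p i * prod_weight p d N y"
  by (simp add: div_mod_append)

lemma digit_sum_append:
  "y < d ^ N \<Longrightarrow> digit_sum f d (Suc N) (i * d ^ N + y) = f i + digit_sum f d N y"
  by (simp add: div_mod_append)

lemma centred_digit_sum_append:
  "y < d ^ N \<Longrightarrow> digit_sum f d (Suc N) (i * d ^ N + y) - Suc N * (m :: real) = (f i - m) + (digit_sum f d N y - N * m)"
  unfolding digit_sum_append by (simp add: algebra_simps)

lemma prod_weight_nonneg: "x < d ^ N \<Longrightarrow> prod_weight p d N x \<ge> 0"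
proof (induction N arbitrary: x)
  case (Suc N)
  hence "x < d * d ^ N" by simp
  from div_mod_less_mult[OF this] show ?case using Suc.IH p_nonneg by simp
qed simp

text \<open>Conditioning on the leading digit; all moment computations below proceed by this
  recursion.\<close>

lemma prod_weight_sum_Suc:
  "(\<Sum>x<d ^ Suc N. prod_weight p d (Suc N) x * F x)
    = (\<Sum>i<d. p i * (\<Sum>y<d ^ N. prod_weight p d N y * F (i * d ^ N + y)))"
  by (simp add: sum_lessThan_mult prod_weight_append sum_distrib_left mult.assoc
      del: prod_weight.simps)

lemma prod_weight_sum: "(\<Sum>x<d ^ N. prod_weight p d N x) = 1"
proof (induction N)
  case (Suc N)
  show ?case using prod_weight_sum_Suc[where F = "\<lambda>_. 1", of N] Suc p_sum by simp
qed simp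

lemma prod_weight_mean:
  assumes "(\<Sum>i<d. p i * f i) = m"
  shows "(\<Sum>x<d ^ N. prod_weight p d N x * (digit_sum f d N x - N * m)) = 0"
proof (induction N)
  case (Suc N)
  have "(\<Sum>x<d ^ Suc N. prod_weight p d (Suc N) x * (digit_sum f d (Suc N) x - Suc N * m))
      = (\<Sum>i<d. p i * (\<Sum>y<d ^ N. prod_weight p d N y * ((f i - m) + (digit_sum f d N y - N * m))))"
    unfolding prod_weight_sum_Suc
    by (rule sum.cong[OF refl], rule arg_cong[where f = "(*) _"], rule sum.cong[OF refl])
      (subst centred_digit_sum_append, simp, rule refl)
  also have "\<dots> = (\<Sum>i<d. p i * (f i - m))"
    using Suc.IH prod_weight_sum[of N]
    by (simp add: distrib_left sum.distrib flip: sum_distrib_right)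
  also have "\<dots> = 0" using assms p_sum by (simp add: right_diff_distrib sum_subtractf flip: sum_distrib_right)
  finally show ?case .
qed simp

text \<open>Variances of independent digits add: the cross term vanishes because the centred sum of
  the remaining digits has mean 0.\<close>

lemma prod_weight_variance:
  assumes m: "(\<Sum>i<d. p i * f i) = m"
  shows "(\<Sum>x<d ^ N. prod_weight p d N x * (digit_sum f d N x - N * m)\<^sup>2) = N * (\<Sum>i<d. p i * (f i - m)\<^sup>2)"
proof (induction N)
  case (Suc N)
  let ?w = "prod_weight p d N" and ?X = "\<lambda>y. digit_sum f d N y - N * m"
  have inner: "(\<Sum>y<d ^ N. ?w y * (c + ?X y)\<^sup>2) = c\<^sup>2 + N * (\<Sum>i<d. p i * (f i - m)\<^sup>2)" for c
  proof -
    have "(\<Sum>y<d ^ N. ?w y * (c + ?X y)\<^sup>2)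
        = (\<Sum>y<d ^ N. c\<^sup>2 * ?w y + 2 * c * (?w y * ?X y) + ?w y * (?X y)\<^sup>2)"
      by (intro sum.cong refl) (simp add: power2_eq_square algebra_simps)
    also have "\<dots> = c\<^sup>2 * (\<Sum>y<d ^ N. ?w y) + 2 * c * (\<Sum>y<d ^ N. ?w y * ?X y) + (\<Sum>y<d ^ N. ?w y * (?X y)\<^sup>2)"
      by (simp add: sum.distrib sum_distrib_left)
    finally show ?thesis using Suc.IH prod_weight_sum[of N] prod_weight_mean[OF m, of N] by simp
  qed
  have "(\<Sum>x<d ^ Suc N. prod_weight p d (Suc N) x * (digit_sum f d (Suc N) x - Suc N * m)\<^sup>2)
      = (\<Sum>i<d. p i * (\<Sum>y<d ^ N. ?w y * ((f i - m) + ?X y)\<^sup>2))"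
    unfolding prod_weight_sum_Suc
    by (rule sum.cong[OF refl], rule arg_cong[where f = "(*) _"], rule sum.cong[OF refl])
      (subst centred_digit_sum_append, simp, rule refl)
  also have "\<dots> = (\<Sum>i<d. p i * (f i - m)\<^sup>2) + (\<Sum>i<d. p i) * (N * (\<Sum>i<d. p i * (f i - m)\<^sup>2))"
    unfolding inner by (simp add: distrib_left sum.distrib sum_distrib_right)
  finally show ?case using p_sum by (simp add: algebra_simps)
qed simp

lemma prod_weight_chebyshev:
  assumes m: "(\<Sum>i<d. p i * f i) = m" and \<epsilon>: "\<epsilon> > 0" and N: "N > 0"
  shows "(\<Sum>x | x < d ^ N \<and> \<bar>digit_sum f d N x - N * m\<bar> \<ge> N * \<epsilon>. prod_weight p d N x)
    \<le> (\<Sum>i<d. p i * (f i - m)\<^sup>2) / \<epsilon>\<^sup>2 / N"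
proof -
  let ?w = "prod_weight p d N" and ?X = "\<lambda>y. digit_sum f d N y - N * m"
  let ?B = "{x. x < d ^ N \<and> \<bar>?X x\<bar> \<ge> N * \<epsilon>}"
  have "(N * \<epsilon>)\<^sup>2 * (\<Sum>x\<in>?B. ?w x) \<le> (\<Sum>x\<in>?B. ?w x * (?X x)\<^sup>2)"
    unfolding sum_distrib_left
  proof (rule sum_mono)
    fix x assume x: "x \<in> ?B"
    have "(N * \<epsilon>)\<^sup>2 \<le> \<bar>?X x\<bar>\<^sup>2" using x \<epsilon> by (intro power_mono) auto
    thus "(N * \<epsilon>)\<^sup>2 * ?w x \<le> ?w x * (?X x)\<^sup>2"
      using prod_weight_nonneg[of x N] x by (simp add: mult.commute mult_left_mono)
  qed
  also have "\<dots> \<le> (\<Sum>x<d ^ N. ?w x * (?X x)\<^sup>2)"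
    by (rule sum_mono2) (auto simp: prod_weight_nonneg)
  also have "\<dots> = N * (\<Sum>i<d. p i * (f i - m)\<^sup>2)" by (rule prod_weight_variance[OF m])
  finally show ?thesis using \<epsilon> N by (simp add: field_simps power2_eq_square)
qed

text \<open>Logarithms turn the product into a sum over digits. The weight must be nonzero because
  \<open>surprisal\<close> takes the conventional value 0 on digits of probability 0.\<close>

lemma prod_weight_surprisal:
  "x < d ^ N \<Longrightarrow> prod_weight p d N x \<noteq> 0
    \<Longrightarrow> prod_weight p d N x = 2 powr (- digit_sum (\<lambda>i. surprisal (p i)) d N x)"
proof (induction N arbitrary: x)
  case (Suc N)
  have x: "x < d * d ^ N" using Suc.prems by simp
  note dm = div_mod_less_mult[OF x]
  have "p (x div d ^ N) > 0" using Suc.prems(2) p_nonneg[OF dm(1)] by (auto simp: less_le)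
  hence "p (x div d ^ N) = 2 powr (- surprisal (p (x div d ^ N)))"
    by (simp add: surprisal_def)
  moreover have "prod_weight p d N (x mod d ^ N) = 2 powr (- digit_sum (\<lambda>i. surprisal (p i)) d N (x mod d ^ N))"
    using Suc.IH[OF dm(2)] Suc.prems(2) by simp
  ultimately have "p (x div d ^ N) * prod_weight p d N (x mod d ^ N)
      = 2 powr (- surprisal (p (x div d ^ N))) * 2 powr (- digit_sum (\<lambda>i. surprisal (p i)) d N (x mod d ^ N))"
    by (rule arg_cong2)
  thus ?case by (simp flip: powr_add)
qed simp

lemma surprisal_mean: "(\<Sum>i<d. p i * surprisal (p i)) = - (\<Sum>i<d. eta (p i))"
  unfolding sum_negf[symmetric] by (intro sum.cong) (auto simp: surprisal_def eta_def)

text \<open>Asymptotic equipartition: a weight outside the two thresholds means that the digit sum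
  of the surprisal deviates from its mean \<open>N * S\<close> by at least
  \<open>N * \<epsilon>\<close>. The lower tail feeds the direct part, the upper tail the
  converse.\<close>

lemma atypical_weight_tendsto_0:
  fixes \<epsilon> :: real
  defines "S \<equiv> - (\<Sum>i<d. eta (p i))"
  assumes \<epsilon>: "\<epsilon> > 0" and \<delta>: "\<delta> > 0"
  obtains N0 where
    "\<And>N. N \<ge> N0 \<Longrightarrow> (\<Sum>x | x < d ^ N \<and> prod_weight p d N x < 2 powr (- (N * (S + \<epsilon>))). prod_weight p d N x) \<le> \<delta>"
    "\<And>N. N \<ge> N0 \<Longrightarrow> (\<Sum>x | x < d ^ N \<and> prod_weight p d N x > 2 powr (- (N * (S - \<epsilon>))). prod_weight p d N x) \<le> \<delta>"
proof -
  let ?f = "\<lambda>i. surprisal (p i)"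
  define V where "V = (\<Sum>i<d. p i * (?f i - S)\<^sup>2) / \<epsilon>\<^sup>2"
  \<comment> \<open>Chebyshev's bound is \<open>V / N\<close>, which is at most \<delta> from here
    on.\<close>
  define N0 where "N0 = Suc (nat \<lceil>V / \<delta>\<rceil>)"
  have m: "(\<Sum>i<d. p i * ?f i) = S" unfolding S_def by (rule surprisal_mean)
  have main: "(\<Sum>x | x < d ^ N \<and> P x. prod_weight p d N x) \<le> \<delta>"
    if N: "N \<ge> N0"
      and P: "\<And>x. x < d ^ N \<Longrightarrow> P x \<Longrightarrow> prod_weight p d N x \<noteq> 0 \<Longrightarrow> \<bar>digit_sum ?f d N x - N * S\<bar> \<ge> N * \<epsilon>" for N P
  proof -
    have N': "N > 0" using N by (simp add: N0_def)
    have "V / \<delta> \<le> real_of_int \<lceil>V / \<delta>\<rceil>" by (rule le_of_int_ceiling)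
    also have "\<dots> \<le> real (nat \<lceil>V / \<delta>\<rceil>)" by simp
    also have "\<dots> \<le> N" using N unfolding N0_def by linarith
    finally have VN: "V / N \<le> \<delta>" using N' \<delta> by (simp add: field_simps)
    \<comment> \<open>Indices of weight 0 lie in the lower tail without a large digit sum being
      guaranteed; they contribute nothing and are dropped first.\<close>
    have "(\<Sum>x | x < d ^ N \<and> P x. prod_weight p d N x) = (\<Sum>x | x < d ^ N \<and> P x \<and> prod_weight p d N x \<noteq> 0. prod_weight p d N x)"
      by (rule sum.mono_neutral_right) auto
    also have "\<dots> \<le> (\<Sum>x | x < d ^ N \<and> \<bar>digit_sum ?f d N x - N * S\<bar> \<ge> N * \<epsilon>. prod_weight p d N x)"
      by (rule sum_mono2) (use P prod_weight_nonneg in auto)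
    also have "\<dots> \<le> V / N" unfolding V_def by (rule prod_weight_chebyshev[OF m \<epsilon> N'])
    finally show ?thesis using VN by simp
  qed
  show ?thesis
  proof (rule that)
    fix N assume N: "N \<ge> N0"
    show "(\<Sum>x | x < d ^ N \<and> prod_weight p d N x < 2 powr (- (N * (S + \<epsilon>))). prod_weight p d N x) \<le> \<delta>"
      by (rule main[OF N]) (auto simp: prod_weight_surprisal abs_le_iff algebra_simps)
    show "(\<Sum>x | x < d ^ N \<and> prod_weight p d N x > 2 powr (- (N * (S - \<epsilon>))). prod_weight p d N x) \<le> \<delta>"
      by (rule main[OF N]) (auto simp: prod_weight_surprisal abs_le_iff algebra_simps)
  qed
qed

end

subsection \<open>Upper bound on the entanglement fidelity\<close>

lemma sum_rotate3: "(\<Sum>i\<in>A. \<Sum>j\<in>B. \<Sum>z\<in>C. f i j z) = (\<Sum>z\<in>C. \<Sum>i\<in>A. \<Sum>j\<in>B. f i j z)"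
proof -
  have "(\<Sum>i\<in>A. \<Sum>j\<in>B. \<Sum>z\<in>C. f i j z) = (\<Sum>i\<in>A. \<Sum>z\<in>C. \<Sum>j\<in>B. f i j z)"
    by (rule sum.cong[OF refl], rule sum.swap)
  also have "\<dots> = (\<Sum>z\<in>C. \<Sum>i\<in>A. \<Sum>j\<in>B. f i j z)" by (rule sum.swap)
  finally show ?thesis .
qed

text \<open>Lagrange's identity: the difference of the two sides is half a double sum of
  squares.\<close>

lemma Cauchy_Schwarz_sum:
  fixes f g :: "'a \<Rightarrow> real"
  shows "(\<Sum>x\<in>A. f x * g x)\<^sup>2 \<le> (\<Sum>x\<in>A. (f x)\<^sup>2) * (\<Sum>x\<in>A. (g x)\<^sup>2)"
proof -
  have "0 \<le> (\<Sum>x\<in>A. \<Sum>y\<in>A. (f x * g y - f y * g x)\<^sup>2)"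
    by (intro sum_nonneg) auto
  also have "\<dots> = (\<Sum>x\<in>A. \<Sum>y\<in>A. (f x)\<^sup>2 * (g y)\<^sup>2 + (g x)\<^sup>2 * (f y)\<^sup>2 - 2 * ((f x * g x) * (f y * g y)))"
    by (intro sum.cong refl) (simp add: power2_eq_square algebra_simps)
  also have "\<dots> = 2 * ((\<Sum>x\<in>A. (f x)\<^sup>2) * (\<Sum>x\<in>A. (g x)\<^sup>2)) - 2 * (\<Sum>x\<in>A. f x * g x)\<^sup>2"
    unfolding sum.distrib sum_subtractf sum_distrib_left[symmetric] sum_distrib_right[symmetric] power2_eq_square[of "sum _ _"]
    by (simp add: mult.commute)
  finally show ?thesis by simp
qed

lemma weighted_Cauchy_Schwarz:
  fixes u w :: "'a \<Rightarrow> complex"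
  assumes "\<And>x. x \<in> A \<Longrightarrow> q x \<ge> 0"
  shows "(cmod (\<Sum>x\<in>A. of_real (q x) * (u x * w x)))\<^sup>2
    \<le> (\<Sum>x\<in>A. q x * (cmod (u x))\<^sup>2) * (\<Sum>x\<in>A. q x * (cmod (w x))\<^sup>2)"
proof -
  have "cmod (\<Sum>x\<in>A. of_real (q x) * (u x * w x)) \<le> (\<Sum>x\<in>A. cmod (of_real (q x) * (u x * w x)))"
    by (rule norm_sum)
  also have "\<dots> = (\<Sum>x\<in>A. (sqrt (q x) * cmod (u x)) * (sqrt (q x) * cmod (w x)))"
    using assms by (intro sum.cong refl) (simp add: norm_mult)
  finally have "(cmod (\<Sum>x\<in>A. of_real (q x) * (u x * w x)))\<^sup>2
      \<le> (\<Sum>x\<in>A. (sqrt (q x) * cmod (u x)) * (sqrt (q x) * cmod (w x)))\<^sup>2"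
    by (rule power_mono) simp
  also have "\<dots> \<le> (\<Sum>x\<in>A. (sqrt (q x) * cmod (u x))\<^sup>2) * (\<Sum>x\<in>A. (sqrt (q x) * cmod (w x))\<^sup>2)"
    by (rule Cauchy_Schwarz_sum)
  also have "\<dots> = (\<Sum>x\<in>A. q x * (cmod (u x))\<^sup>2) * (\<Sum>x\<in>A. q x * (cmod (w x))\<^sup>2)"
    using assms by (intro arg_cong2[of _ _ _ _ "(*)"] sum.cong refl) (simp_all add: power_mult_distrib)
  finally show ?thesis .
qed

lemma cmod_add_power2_le: "(cmod (u + w))\<^sup>2 \<le> 2 * (cmod u)\<^sup>2 + 2 * (cmod w)\<^sup>2"
proof -
  have "(cmod (u + w))\<^sup>2 \<le> (cmod u + cmod w)\<^sup>2" by (intro power_mono norm_triangle_ineq) simp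
  also have "\<dots> \<le> (cmod u + cmod w)\<^sup>2 + (cmod u - cmod w)\<^sup>2" by simp
  also have "\<dots> = 2 * (cmod u)\<^sup>2 + 2 * (cmod w)\<^sup>2" by (simp add: power2_eq_square algebra_simps)
  finally show ?thesis .
qed

text \<open>The bound behind the converse: \<open>a\<close> and \<open>b\<close> are the Kraus operators of the decoder and the
  encoder, \<open>m\<close> is the dimension of the compressed system. Indices of weight above \<open>t\<close> contribute at
  most the square of their total weight because the composition is a channel; for the others,
  Cauchy-Schwarz separates decoder from encoder, and the decoder contributes at most \<open>t * m\<close>.\<close>

lemma kraus_overlap_bound:
  fixes a :: "'i \<Rightarrow> nat \<Rightarrow> nat \<Rightarrow> complex" and b :: "'j \<Rightarrow> nat \<Rightarrow> nat \<Rightarrow> complex"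
  assumes q: "\<And>x. x < n \<Longrightarrow> q x \<ge> 0" "(\<Sum>x<n. q x) = 1" and t: "t \<ge> 0"
    and a: "\<And>c. (\<Sum>i\<in>I. \<Sum>z<n. (cmod (\<Sum>y<m. a i z y * c y))\<^sup>2) = (\<Sum>y<m. (cmod (c y))\<^sup>2)"
    and b: "\<And>x. x < n \<Longrightarrow> (\<Sum>j\<in>J. \<Sum>y<m. (cmod (b j y x))\<^sup>2) = 1"
  shows "(\<Sum>i\<in>I. \<Sum>j\<in>J. (cmod (\<Sum>x<n. of_real (q x) * (\<Sum>y<m. a i x y * b j y x)))\<^sup>2)
    \<le> 2 * (\<Sum>x | x < n \<and> q x > t. q x)\<^sup>2 + 2 * (t * real m)"
proof -
  define H where "H = {x. x < n \<and> q x > t}"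
  define K where "K = {x. x < n \<and> q x \<le> t}"
  have fin: "finite H" "finite K" and HK: "{..<n} = H \<union> K" "H \<inter> K = {}" by (auto simp: H_def K_def)
  have qH: "q x \<ge> 0" if "x \<in> H" for x using q(1) that by (simp add: H_def)
  have qK: "q x \<ge> 0" "q x \<le> t" if "x \<in> K" for x using q(1) that by (auto simp: K_def)
  define c where "c i j x = (\<Sum>y<m. a i x y * b j y x)" for i j x
  define u where "u i j = (\<Sum>x\<in>H. of_real (q x) * c i j x)" for i j
  define w where "w i j = (\<Sum>x\<in>K. of_real (q x) * c i j x)" for i j
  have split: "(\<Sum>x<n. of_real (q x) * c i j x) = u i j + w i j" for i j
    unfolding HK(1) u_def w_def by (rule sum.union_disjoint) (use fin HK in auto)
  \<comment> \<open>\<open>c i j x\<close> is the single component \<open>z = x\<close> of the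
    output on input \<open>x\<close>, and all components together have squared norm 1.\<close>
  have c1: "(\<Sum>i\<in>I. \<Sum>j\<in>J. (cmod (c i j x))\<^sup>2) \<le> 1" if x: "x < n" for x
  proof -
    have "(\<Sum>i\<in>I. \<Sum>j\<in>J. (cmod (c i j x))\<^sup>2) = (\<Sum>j\<in>J. \<Sum>i\<in>I. (cmod (c i j x))\<^sup>2)"
      by (rule sum.swap)
    also have "\<dots> \<le> (\<Sum>j\<in>J. \<Sum>i\<in>I. \<Sum>z<n. (cmod (\<Sum>y<m. a i z y * b j y x))\<^sup>2)"
      unfolding c_def using x by (intro sum_mono member_le_sum) auto
    also have "\<dots> = 1" unfolding a using b[OF x] by simp
    finally show ?thesis .
  qed
  have "(cmod (u i j))\<^sup>2 \<le> (\<Sum>x\<in>H. q x) * (\<Sum>x\<in>H. q x * (cmod (c i j x))\<^sup>2)" for i j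
    using weighted_Cauchy_Schwarz[of H q "\<lambda>_. 1" "c i j"] qH by (simp add: u_def)
  hence "(\<Sum>i\<in>I. \<Sum>j\<in>J. (cmod (u i j))\<^sup>2)
      \<le> (\<Sum>i\<in>I. \<Sum>j\<in>J. (\<Sum>x\<in>H. q x) * (\<Sum>x\<in>H. q x * (cmod (c i j x))\<^sup>2))"
    by (intro sum_mono)
  also have "\<dots> = (\<Sum>x\<in>H. q x) * (\<Sum>i\<in>I. \<Sum>j\<in>J. \<Sum>x\<in>H. q x * (cmod (c i j x))\<^sup>2)"
    by (simp only: sum_distrib_left)
  also have "\<dots> = (\<Sum>x\<in>H. q x) * (\<Sum>x\<in>H. q x * (\<Sum>i\<in>I. \<Sum>j\<in>J. (cmod (c i j x))\<^sup>2))"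
    by (subst sum_rotate3) (simp only: sum_distrib_left)
  also have "\<dots> \<le> (\<Sum>x\<in>H. q x) * (\<Sum>x\<in>H. q x * 1)"
    using c1 qH by (intro mult_left_mono sum_mono sum_nonneg) (auto simp: H_def)
  finally have U: "(\<Sum>i\<in>I. \<Sum>j\<in>J. (cmod (u i j))\<^sup>2) \<le> (\<Sum>x\<in>H. q x)\<^sup>2"
    by (simp add: power2_eq_square)
  \<comment> \<open>As one sum over pairs, Cauchy-Schwarz bounds it by a factor depending only on
    \<open>i\<close> times one depending only on \<open>j\<close>, so the sums over Kraus operators
    factor.\<close>
  have wij: "w i j = (\<Sum>(x, y)\<in>K \<times> {..<m}. of_real (q x) * (a i x y * b j y x))" for i j
    unfolding w_def c_def sum_distrib_left by (rule sum.cartesian_product)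
  have "(cmod (w i j))\<^sup>2 \<le> (\<Sum>x\<in>K. \<Sum>y<m. q x * (cmod (a i x y))\<^sup>2) * (\<Sum>x\<in>K. \<Sum>y<m. q x * (cmod (b j y x))\<^sup>2)" for i j
    using weighted_Cauchy_Schwarz[of "K \<times> {..<m}" "\<lambda>z. q (fst z)" "\<lambda>(x, y). a i x y" "\<lambda>(x, y). b j y x"] qK(1)
    unfolding wij sum.cartesian_product by (auto simp: case_prod_beta')
  hence "(\<Sum>i\<in>I. \<Sum>j\<in>J. (cmod (w i j))\<^sup>2)
      \<le> (\<Sum>i\<in>I. \<Sum>j\<in>J. (\<Sum>x\<in>K. \<Sum>y<m. q x * (cmod (a i x y))\<^sup>2) * (\<Sum>x\<in>K. \<Sum>y<m. q x * (cmod (b j y x))\<^sup>2))"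
    by (intro sum_mono)
  also have "\<dots> = (\<Sum>i\<in>I. \<Sum>x\<in>K. \<Sum>y<m. q x * (cmod (a i x y))\<^sup>2) * (\<Sum>j\<in>J. \<Sum>x\<in>K. \<Sum>y<m. q x * (cmod (b j y x))\<^sup>2)"
    by (rule sum_product[symmetric])
  also have "\<dots> \<le> (t * m) * 1"
  proof (rule mult_mono)
    have "(\<Sum>i\<in>I. \<Sum>x\<in>K. \<Sum>y<m. q x * (cmod (a i x y))\<^sup>2) \<le> (\<Sum>i\<in>I. \<Sum>x\<in>K. \<Sum>y<m. t * (cmod (a i x y))\<^sup>2)"
      using qK by (intro sum_mono mult_right_mono) auto
    also have "\<dots> \<le> (\<Sum>i\<in>I. \<Sum>x<n. \<Sum>y<m. t * (cmod (a i x y))\<^sup>2)"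
      using t by (intro sum_mono sum_mono2 sum_nonneg) (auto simp: K_def)
    also have "\<dots> = (\<Sum>y<m. t * (\<Sum>i\<in>I. \<Sum>x<n. (cmod (a i x y))\<^sup>2))"
      by (subst sum_rotate3) (simp add: sum_distrib_left)
    also have "\<dots> = (\<Sum>y<m. t * 1)"
    proof (rule sum.cong[OF refl])
      fix y assume y: "y \<in> {..<m}"
      \<comment> \<open>Taking a unit vector as input shows that each of the \<open>m\<close>
        columns of the stacked decoder has norm 1; the dimension enters the bound here.\<close>
      have "(\<Sum>i\<in>I. \<Sum>x<n. (cmod (a i x y))\<^sup>2) = (\<Sum>y'<m. (cmod (if y' = y then 1 else 0 :: complex))\<^sup>2)"
        unfolding a[symmetric] using y by (simp add: if_distrib[of "\<lambda>x. _ * x"] cong: if_cong)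
      also have "\<dots> = (\<Sum>y'<m. if y' = y then 1 else 0)" by (intro sum.cong) auto
      finally show "t * (\<Sum>i\<in>I. \<Sum>x<n. (cmod (a i x y))\<^sup>2) = t * 1" using y by simp
    qed
    finally show "(\<Sum>i\<in>I. \<Sum>x\<in>K. \<Sum>y<m. q x * (cmod (a i x y))\<^sup>2) \<le> t * m" by (simp add: mult.commute)
    have "(\<Sum>j\<in>J. \<Sum>x\<in>K. \<Sum>y<m. q x * (cmod (b j y x))\<^sup>2) = (\<Sum>x\<in>K. q x * (\<Sum>j\<in>J. \<Sum>y<m. (cmod (b j y x))\<^sup>2))"
      by (subst sum.swap) (simp add: sum_distrib_left)
    also have "\<dots> = (\<Sum>x\<in>K. q x)" using b by (intro sum.cong) (auto simp: K_def)
    also have "\<dots> \<le> (\<Sum>x<n. q x)" by (rule sum_mono2) (auto simp: K_def q)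
    finally show "(\<Sum>j\<in>J. \<Sum>x\<in>K. \<Sum>y<m. q x * (cmod (b j y x))\<^sup>2) \<le> 1" using q by simp
    show "0 \<le> t * m" using t by simp
    show "0 \<le> (\<Sum>j\<in>J. \<Sum>x\<in>K. \<Sum>y<m. q x * (cmod (b j y x))\<^sup>2)"
      using qK by (intro sum_nonneg) auto
  qed
  finally have Wb: "(\<Sum>i\<in>I. \<Sum>j\<in>J. (cmod (w i j))\<^sup>2) \<le> t * m" by simp
  have "(\<Sum>i\<in>I. \<Sum>j\<in>J. (cmod (\<Sum>x<n. of_real (q x) * c i j x))\<^sup>2)
      \<le> (\<Sum>i\<in>I. \<Sum>j\<in>J. 2 * (cmod (u i j))\<^sup>2 + 2 * (cmod (w i j))\<^sup>2)"
    unfolding split by (intro sum_mono cmod_add_power2_le)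
  also have "\<dots> = 2 * (\<Sum>i\<in>I. \<Sum>j\<in>J. (cmod (u i j))\<^sup>2) + 2 * (\<Sum>i\<in>I. \<Sum>j\<in>J. (cmod (w i j))\<^sup>2)"
    by (simp add: sum.distrib sum_distrib_left)
  also have "\<dots> \<le> 2 * (\<Sum>x\<in>H. q x)\<^sup>2 + 2 * (t * m)" using U Wb by simp
  finally show ?thesis by (simp add: c_def H_def)
qed

section \<open>Kraus families as isometries\<close>

lemma braket_adjoint_mult:
  assumes K: "K \<in> carrier_mat m d"
  shows "braket (vec d c) (mat_adjoint K * K) = of_real (\<Sum>z<m. (cmod (\<Sum>y<d. K $$ (z, y) * c y))\<^sup>2)"
proof -
  have "braket (vec d c) (mat_adjoint K * K)
      = (\<Sum>i<d. \<Sum>j<d. \<Sum>z<m. cnj (K $$ (z, i) * c i) * (K $$ (z, j) * c j))"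
    unfolding braket_def
    by (intro sum.cong) (use K in \<open>auto simp: mat_mult_index[OF mat_adjoint_carrier[OF K] K]
      sum_distrib_left sum_distrib_right mult_ac simp del: index_mult_mat(1)\<close>)
  also have "\<dots> = (\<Sum>z<m. \<Sum>i<d. \<Sum>j<d. cnj (K $$ (z, i) * c i) * (K $$ (z, j) * c j))"
    by (rule sum_rotate3)
  also have "\<dots> = (\<Sum>z<m. cnj (\<Sum>y<d. K $$ (z, y) * c y) * (\<Sum>y<d. K $$ (z, y) * c y))"
    unfolding cnj_sum sum_product ..
  also have "\<dots> = (\<Sum>z<m. of_real ((cmod (\<Sum>y<d. K $$ (z, y) * c y))\<^sup>2))"
    by (intro sum.cong refl) (simp only: complex_norm_square mult.commute)
  finally show ?thesis by simp
qed

text \<open>Completeness says that the Kraus operators stacked on top of each other form an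
  isometry; this is its norm identity on the vector \<open>c\<close>.\<close>

lemma kraus_isometry:
  assumes K: "\<And>K. K \<in> set Ks \<Longrightarrow> K \<in> carrier_mat m d"
    and one: "msum d (map (\<lambda>K. mat_adjoint K * K) Ks) = 1\<^sub>m d"
  shows "(\<Sum>k<length Ks. \<Sum>z<m. (cmod (\<Sum>y<d. Ks ! k $$ (z, y) * c y))\<^sup>2) = (\<Sum>y<d. (cmod (c y))\<^sup>2)"
proof -
  have "complex_of_real (\<Sum>k<length Ks. \<Sum>z<m. (cmod (\<Sum>y<d. Ks ! k $$ (z, y) * c y))\<^sup>2)
      = (\<Sum>k<length Ks. braket (vec d c) (mat_adjoint (Ks ! k) * (Ks ! k)))"
    unfolding of_real_sum[of _ "{..<length Ks}"] using braket_adjoint_mult[OF K] by (intro sum.cong) auto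
  also have "\<dots> = (\<Sum>x\<leftarrow>map (\<lambda>K. mat_adjoint K * K) Ks. braket (vec d c) x)"
    by (simp add: sum_list_sum_nth atLeast0LessThan)
  also have "\<dots> = braket (vec d c) (1\<^sub>m d)"
    unfolding one[symmetric] by (rule braket_msum[symmetric]) (use K in \<open>auto intro!: mult_carrier_mat[of _ d m _ d]\<close>)
  also have "\<dots> = (\<Sum>i<d. \<Sum>j<d. if j = i then c i * cnj (c i) else 0)"
    unfolding braket_def by (intro sum.cong) auto
  also have "\<dots> = complex_of_real (\<Sum>y<d. (cmod (c y))\<^sup>2)"
    by (simp add: of_real_sum) (simp only: of_real_power complex_norm_square[symmetric])
  finally show ?thesis using of_real_eq_iff by blast
qed

text \<open>An empty family would sum to 0 instead of the identity. Nonemptiness matters because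
  \<open>apply_channel\<close> reads its output dimension off the first operator.\<close>

lemma ferm_channelD:
  assumes "ferm_channel n m Ks"
  shows "\<And>K. K \<in> set Ks \<Longrightarrow> K \<in> carrier_mat (2 ^ m) (2 ^ n)"
    "msum (2 ^ n) (map (\<lambda>K. mat_adjoint K * K) Ks) = 1\<^sub>m (2 ^ n)" "Ks \<noteq> []"
proof -
  show K: "K \<in> carrier_mat (2 ^ m) (2 ^ n)" if "K \<in> set Ks" for K
    using assms that by (simp add: ferm_channel_def)
  show one: "msum (2 ^ n) (map (\<lambda>K. mat_adjoint K * K) Ks) = 1\<^sub>m (2 ^ n)"
    using assms by (simp add: ferm_channel_def)
  show "Ks \<noteq> []"
  proof
    assume "Ks = []"
    hence "(0\<^sub>m (2 ^ n) (2 ^ n) :: complex mat) = 1\<^sub>m (2 ^ n)" using one by simp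
    hence "(0\<^sub>m (2 ^ n) (2 ^ n) :: complex mat) $$ (0, 0) = 1\<^sub>m (2 ^ n) $$ (0, 0)" by simp
    thus False by simp
  qed
qed

lemma compose_channels_carrier:
  assumes "ferm_channel n m Es" "ferm_channel m n Ds"
  shows "compose_channels Ds Es \<noteq> []"
    "\<And>C. C \<in> set (compose_channels Ds Es) \<Longrightarrow> C \<in> carrier_mat (2 ^ n) (2 ^ n)"
proof -
  note E = ferm_channelD[OF assms(1)] and D = ferm_channelD[OF assms(2)]
  show "compose_channels Ds Es \<noteq> []"
    using E(3) D(3) by (cases Ds; cases Es) (auto simp: compose_channels_def)
  show "C \<in> carrier_mat (2 ^ n) (2 ^ n)" if "C \<in> set (compose_channels Ds Es)" for C
    using that mult_carrier_mat[OF D(1) E(1)] by (auto simp: compose_channels_def)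
qed

lemma sum_list_compose_channels:
  fixes f :: "complex mat \<Rightarrow> real"
  shows "(\<Sum>C\<leftarrow>compose_channels Ds Es. f C) = (\<Sum>i<length Ds. \<Sum>j<length Es. f (Ds ! i * Es ! j))"
proof -
  have "(\<Sum>C\<leftarrow>compose_channels Ds Es. f C) = (\<Sum>D\<leftarrow>Ds. \<Sum>E\<leftarrow>Es. f (D * E))"
    unfolding compose_channels_def by (induction Ds) (auto simp: comp_def)
  thus ?thesis by (simp add: sum_list_sum_nth atLeast0LessThan)
qed

text \<open>The interface between the source and the coding bounds: \<open>q\<close> lists the
  eigenvalues and \<open>g\<close> the parities of the eigenvectors, with no reference to the tensor
  power structure.\<close>

definition parity_eigenbasis :: "nat \<Rightarrow> complex mat \<Rightarrow> complex mat \<Rightarrow> (nat \<Rightarrow> real) \<Rightarrow> (nat \<Rightarrow> bool) \<Rightarrow> bool" where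
  "parity_eigenbasis n \<rho> W q g \<longleftrightarrow> unitary_mat (2 ^ n) W \<and> \<rho> \<in> carrier_mat (2 ^ n) (2 ^ n) \<and>
    \<rho> * W = W * mat_diag (2 ^ n) (\<lambda>x. complex_of_real (q x)) \<and>
    (\<forall>x<2 ^ n. q x \<ge> 0) \<and> (\<Sum>x<2 ^ n. q x) = 1 \<and>
    (\<forall>i<2 ^ n. \<forall>j<2 ^ n. W $$ (i, j) \<noteq> 0 \<longrightarrow> odd_occ i = g j)"

lemma ent_fidelity_compose:
  assumes pe: "parity_eigenbasis n \<rho> W q g" and E: "ferm_channel n m Es" and D: "ferm_channel m n Ds"
  shows "ent_fidelity n \<rho> (compose_channels Ds Es) = (\<Sum>i<length Ds. \<Sum>j<length Es.
    (cmod (\<Sum>x<2 ^ n. of_real (q x) * (mat_adjoint W * (Ds ! i * Es ! j) * W) $$ (x, x)))\<^sup>2)"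
proof -
  have W: "unitary_mat (2 ^ n) W" and \<rho>: "\<rho> \<in> carrier_mat (2 ^ n) (2 ^ n)"
    and RW: "\<rho> * W = W * mat_diag (2 ^ n) (\<lambda>x. complex_of_real (q x))"
    using pe by (auto simp: parity_eigenbasis_def)
  note C = compose_channels_carrier[OF E D]
  have "ent_fidelity n \<rho> (compose_channels Ds Es) = (\<Sum>C\<leftarrow>compose_channels Ds Es. (cmod (mtrace (C * \<rho>)))\<^sup>2)"
    by (rule ent_fidelity_eq[of n W \<rho> q g]) (use pe C in \<open>auto simp: parity_eigenbasis_def\<close>)
  also have "\<dots> = (\<Sum>i<length Ds. \<Sum>j<length Es. (cmod (mtrace (Ds ! i * Es ! j * \<rho>)))\<^sup>2)"
    by (rule sum_list_compose_channels)
  also have "\<dots> = (\<Sum>i<length Ds. \<Sum>j<length Es.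
    (cmod (\<Sum>x<2 ^ n. of_real (q x) * (mat_adjoint W * (Ds ! i * Es ! j) * W) $$ (x, x)))\<^sup>2)"
  proof (intro sum.cong refl)
    fix i j assume "i \<in> {..<length Ds}" "j \<in> {..<length Es}"
    hence "Ds ! i * Es ! j \<in> carrier_mat (2 ^ n) (2 ^ n)"
      using mult_carrier_mat[OF ferm_channelD(1)[OF D] ferm_channelD(1)[OF E]] by simp
    thus "(cmod (mtrace (Ds ! i * Es ! j * \<rho>)))\<^sup>2
      = (cmod (\<Sum>x<2 ^ n. of_real (q x) * (mat_adjoint W * (Ds ! i * Es ! j) * W) $$ (x, x)))\<^sup>2"
      by (simp only: mtrace_mult_eigenbasis[OF W \<rho> RW])
  qed
  finally show ?thesis .
qed

theorem ent_fidelity_upper_bound: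
  assumes pe: "parity_eigenbasis n \<rho> W q g" and E: "ferm_channel n m Es" and D: "ferm_channel m n Ds"
    and t: "t \<ge> 0"
  shows "ent_fidelity n \<rho> (compose_channels Ds Es) \<le> 2 * (\<Sum>x | x < 2 ^ n \<and> q x > t. q x)\<^sup>2 + 2 * (t * 2 ^ m)"
proof -
  let ?n = "2 ^ n :: nat" and ?m = "2 ^ m :: nat"
  have W: "unitary_mat ?n W" and q: "\<And>x. x < ?n \<Longrightarrow> q x \<ge> 0" "(\<Sum>x<?n. q x) = 1"
    using pe by (auto simp: parity_eigenbasis_def)
  have Wc: "W \<in> carrier_mat ?n ?n" using W by (rule unitary_mat_carrier)
  note E' = ferm_channelD[OF E] and D' = ferm_channelD[OF D]
  \<comment> \<open>The decoder absorbs the change of basis at its output, which keeps completeness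
    since \<open>W\<close> is unitary; on the encoder side the columns of \<open>W\<close> serve as
    unit input vectors.\<close>
  define As where "As = map (\<lambda>D. mat_adjoint W * D) Ds"
  have Ac: "A \<in> carrier_mat ?n ?m" if "A \<in> set As" for A
    using that mult_carrier_mat[OF mat_adjoint_carrier[OF Wc] D'(1)] by (auto simp: As_def)
  have "mat_adjoint (mat_adjoint W * D) * (mat_adjoint W * D) = mat_adjoint D * D" if "D \<in> set Ds" for D
  proof -
    have Dc: "D \<in> carrier_mat ?n ?m" using D'(1) that by simp
    have "mat_adjoint (mat_adjoint W * D) * (mat_adjoint W * D) = (mat_adjoint D * W) * (mat_adjoint W * D)"
      using Dc Wc by (simp add: mat_adjoint_mult[of _ ?n ?n _ ?m])
    also have "\<dots> = mat_adjoint D * (W * (mat_adjoint W * D))"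
      by (rule assoc_mult_mat[of _ ?m ?n _ ?n _ ?m]) (use Dc Wc in auto)
    also have "W * (mat_adjoint W * D) = (W * mat_adjoint W) * D"
      by (rule assoc_mult_mat[symmetric, of _ ?n ?n _ ?n _ ?m]) (use Dc Wc in auto)
    finally show ?thesis using Dc by (simp add: unitary_mat_right[OF W])
  qed
  hence A1: "msum ?m (map (\<lambda>K. mat_adjoint K * K) As) = 1\<^sub>m ?m"
    using D'(2) by (simp add: As_def comp_def cong: map_cong)
  note isoA = kraus_isometry[OF Ac A1] and isoE = kraus_isometry[OF E'(1,2)]
  define a where "a i x y = As ! i $$ (x, y)" for i x y
  define b where "b j y x = (\<Sum>z<?n. Es ! j $$ (y, z) * W $$ (z, x))" for j y x
  have entry: "(mat_adjoint W * (Ds ! i * Es ! j) * W) $$ (x, x) = (\<Sum>y<?m. a i x y * b j y x)"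
    if "i < length Ds" "j < length Es" "x < ?n" for i j x
  proof -
    have c: "Ds ! i \<in> carrier_mat ?n ?m" "Es ! j \<in> carrier_mat ?m ?n" using that D'(1) E'(1) by auto
    have "mat_adjoint W * (Ds ! i * Es ! j) * W = (As ! i * Es ! j) * W"
      using that c Wc by (simp add: As_def assoc_mult_mat[of _ ?n ?n _ ?m _ ?n])
    also have "\<dots> = As ! i * (Es ! j * W)"
      by (rule assoc_mult_mat[of _ ?n ?m _ ?n _ ?n]) (use that c Wc Ac in \<open>auto simp: As_def\<close>)
    finally have eq: "mat_adjoint W * (Ds ! i * Es ! j) * W = As ! i * (Es ! j * W)" .
    have Ai: "As ! i \<in> carrier_mat ?n ?m" using that by (intro Ac nth_mem) (simp add: As_def)
    have EW: "Es ! j * W \<in> carrier_mat ?m ?n" using c Wc by auto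
    show ?thesis unfolding eq mat_mult_index[OF Ai EW that(3) that(3)] a_def b_def
      by (intro sum.cong refl) (simp add: mat_mult_index[OF c(2) Wc _ that(3)] del: index_mult_mat)
  qed
  have colW: "(\<Sum>z<?n. (cmod (W $$ (z, x)))\<^sup>2) = 1" if "x < ?n" for x
  proof -
    have "complex_of_real (\<Sum>z<?n. (cmod (W $$ (z, x)))\<^sup>2) = (\<Sum>z<?n. cnj (W $$ (z, x)) * W $$ (z, x))"
      unfolding of_real_sum by (intro sum.cong refl) (simp only: complex_norm_square mult.commute)
    also have "\<dots> = (mat_adjoint W * W) $$ (x, x)"
      using Wc that by (subst mat_mult_index[of _ ?n ?n _ ?n]) auto
    also have "\<dots> = 1" using W that by (simp add: unitary_mat_def)
    finally show ?thesis using of_real_eq_1_iff by blast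
  qed
  have "ent_fidelity n \<rho> (compose_channels Ds Es) = (\<Sum>i<length Ds. \<Sum>j<length Es.
      (cmod (\<Sum>x<?n. of_real (q x) * (\<Sum>y<?m. a i x y * b j y x)))\<^sup>2)"
    unfolding ent_fidelity_compose[OF pe E D]
    by (intro sum.cong refl arg_cong[where f = "\<lambda>z. (cmod z)\<^sup>2"]) (simp add: entry del: index_mult_mat)
  also have "\<dots> \<le> 2 * (\<Sum>x | x < ?n \<and> q x > t. q x)\<^sup>2 + 2 * (t * real ?m)"
  proof (rule kraus_overlap_bound[OF q t])
    show "(\<Sum>i<length Ds. \<Sum>z<?n. (cmod (\<Sum>y<?m. a i z y * c y))\<^sup>2) = (\<Sum>y<?m. (cmod (c y))\<^sup>2)" for c
      using isoA[of c] by (simp add: a_def As_def)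
    show "(\<Sum>j<length Es. \<Sum>y<?m. (cmod (b j y x))\<^sup>2) = 1" if "x < ?n" for x
      unfolding b_def using isoE[of "\<lambda>z. W $$ (z, x)"] colW[OF that] by simp
  qed
  finally show ?thesis by simp
qed

subsection \<open>Coding on a typical subspace\<close>

lemma msum_sandwich:
  assumes A: "A \<in> carrier_mat n d" and B: "B \<in> carrier_mat d n"
  shows "(\<And>x. x \<in> set xs \<Longrightarrow> x \<in> carrier_mat d d)
    \<Longrightarrow> A * msum d xs * B = msum n (map (\<lambda>x. A * x * B) xs)"
proof (induction xs)
  case Nil
  show ?case using A B by simp
next
  case (Cons x xs)
  have x: "x \<in> carrier_mat d d" and m: "msum d xs \<in> carrier_mat d d"
    using Cons.prems by (auto intro!: msum_carrier)
  have "A * (x + msum d xs) * B = (A * x + A * msum d xs) * B"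
    using A x m by (simp add: mult_add_distrib_mat[of _ n d])
  also have "\<dots> = A * x * B + A * msum d xs * B"
    using A B x m by (intro add_mult_distrib_mat[of _ n d]) (auto intro!: mult_carrier_mat[of _ n d])
  finally show ?case using Cons by simp
qed

definition elem_mat :: "nat \<Rightarrow> nat \<Rightarrow> nat \<Rightarrow> nat \<Rightarrow> complex mat" where
  "elem_mat m n a b = mat m n (\<lambda>(i, j). if i = a \<and> j = b then 1 else 0)"

text \<open>A partial isometry \<open>P\<close> with initial space spanned by the basis vectors in \<open>S\<close> is completed to
  a family of Kraus operators by sending the remaining basis vectors to the vacuum.\<close>

definition complete_kraus :: "nat \<Rightarrow> nat \<Rightarrow> nat set \<Rightarrow> complex mat \<Rightarrow> complex mat list" where
  "complete_kraus m n S P = P # map (elem_mat m n 0) (filter (\<lambda>x. x \<notin> S) [0..<n])"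

lemma complete_kraus_carrier:
  "P \<in> carrier_mat m n \<Longrightarrow> K \<in> set (complete_kraus m n S P) \<Longrightarrow> K \<in> carrier_mat m n"
  by (auto simp: complete_kraus_def elem_mat_def)

text \<open>Each added elementary matrix contributes the projector onto one basis vector outside
  \<open>S\<close>, filling the zeros that \<open>P\<close> leaves on the diagonal.\<close>

lemma complete_kraus_sum:
  assumes P: "P \<in> carrier_mat m n" and m: "m > 0"
    and PP: "mat_adjoint P * P = mat_diag n (\<lambda>x. if x \<in> S then 1 else 0)"
  shows "msum n (map (\<lambda>K. mat_adjoint K * K) (complete_kraus m n S P)) = 1\<^sub>m n"
proof (rule eq_matI)
  let ?Ks = "complete_kraus m n S P"
  have E: "elem_mat m n 0 x \<in> carrier_mat m n" for x by (simp add: elem_mat_def)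
  have c: "K \<in> carrier_mat n n" if "K \<in> set (map (\<lambda>K. mat_adjoint K * K) ?Ks)" for K
    using that complete_kraus_carrier[OF P] by (auto intro!: mult_carrier_mat[of _ n m _ n])
  fix i j assume "i < dim_row (1\<^sub>m n :: complex mat)" "j < dim_col (1\<^sub>m n :: complex mat)"
  hence ij: "i < n" "j < n" by auto
  have EE: "(mat_adjoint (elem_mat m n 0 x) * elem_mat m n 0 x) $$ (i, j) = (if i = x \<and> j = x then 1 else 0)" for x
  proof -
    have "(mat_adjoint (elem_mat m n 0 x) * elem_mat m n 0 x) $$ (i, j)
        = (\<Sum>l<m. if l = 0 then (if i = x \<and> j = x then 1 else 0) else 0)"
      unfolding mat_mult_index[OF mat_adjoint_carrier[OF E] E ij]
      using ij by (intro sum.cong) (auto simp: elem_mat_def)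
    thus ?thesis using m by simp
  qed
  have "msum n (map (\<lambda>K. mat_adjoint K * K) ?Ks) $$ (i, j)
      = (\<Sum>K\<leftarrow>?Ks. (mat_adjoint K * K) $$ (i, j))"
    by (subst msum_index[OF c ij]) (simp_all add: comp_def)
  also have "\<dots> = mat_diag n (\<lambda>x. if x \<in> S then 1 else 0) $$ (i, j)
      + (\<Sum>x\<leftarrow>filter (\<lambda>x. x \<notin> S) [0..<n]. if i = x \<and> j = x then 1 else 0)"
    unfolding complete_kraus_def by (simp add: PP comp_def EE del: index_mult_mat mat_diag_index)
  also have "(\<Sum>x\<leftarrow>filter (\<lambda>x. x \<notin> S) [0..<n]. if i = x \<and> j = x then 1 else 0)
      = (\<Sum>x | x < n \<and> x \<notin> S. if x = i then (if i = j then 1 else 0 :: complex) else 0)"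
    by (subst sum_list_distinct_conv_sum_set) (auto intro!: sum.cong)
  also have "\<dots> = (if i = j \<and> i \<notin> S then 1 else 0)" using ij by simp
  also have "mat_diag n (\<lambda>x. if x \<in> S then 1 else 0) $$ (i, j) + (if i = j \<and> i \<notin> S then 1 else 0) = (1\<^sub>m n :: complex mat) $$ (i, j)"
    using ij by simp
  finally show "msum n (map (\<lambda>K. mat_adjoint K * K) ?Ks) $$ (i, j) = 1\<^sub>m n $$ (i, j)" .
next
  have "msum n (map (\<lambda>K. mat_adjoint K * K) (complete_kraus m n S P)) \<in> carrier_mat n n"
    using complete_kraus_carrier[OF P] by (intro msum_carrier) (auto intro!: mult_carrier_mat[of _ n m _ n])
  thus "dim_row (msum n (map (\<lambda>K. mat_adjoint K * K) (complete_kraus m n S P))) = dim_row (1\<^sub>m n)"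
    "dim_col (msum n (map (\<lambda>K. mat_adjoint K * K) (complete_kraus m n S P))) = dim_col (1\<^sub>m n)" by auto
qed

text \<open>Homogeneity for arbitrary gradings of rows and columns. Eigenvector labels are graded by
  \<open>g\<close> and Fock indices by \<open>odd_occ\<close>, so the factors of a Kraus operator
  need this more general form of \<open>parity_definite\<close>.\<close>

definition shift_grade :: "nat \<Rightarrow> nat \<Rightarrow> complex mat \<Rightarrow> (nat \<Rightarrow> bool) \<Rightarrow> (nat \<Rightarrow> bool) \<Rightarrow> bool" where
  "shift_grade m n P r c \<longleftrightarrow> (\<exists>b. \<forall>y<m. \<forall>x<n. P $$ (y, x) \<noteq> 0 \<longrightarrow> (r y = c x) = b)"

text \<open>\<open>P\<close> preserves the grade, while an elementary matrix has a single nonzero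
  entry and so is homogeneous whatever the grades are.\<close>

lemma shift_grade_complete_kraus:
  assumes "\<And>y x. y < m \<Longrightarrow> x < n \<Longrightarrow> P $$ (y, x) \<noteq> 0 \<Longrightarrow> r y = c x" "K \<in> set (complete_kraus m n S P)"
  shows "shift_grade m n K r c"
proof (cases "K = P")
  case True
  thus ?thesis unfolding shift_grade_def using assms(1) by (intro exI[of _ True]) blast
next
  case False
  then obtain x0 where K: "K = elem_mat m n 0 x0" using assms(2) by (auto simp: complete_kraus_def)
  have "y = 0 \<and> x = x0" if "y < m" "x < n" "K $$ (y, x) \<noteq> 0" for y x
    using that by (simp add: K elem_mat_def split: if_splits)
  thus ?thesis unfolding shift_grade_def by (intro exI[of _ "r 0 = c x0"]) blast
qed

lemma parity_definite_shift_grade: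
  assumes K: "K \<in> carrier_mat m n" and s: "shift_grade m n K odd_occ odd_occ"
  shows "parity_definite K"
proof -
  obtain b where b: "\<forall>y<m. \<forall>x<n. K $$ (y, x) \<noteq> 0 \<longrightarrow> (odd_occ y = odd_occ x) = b"
    using s unfolding shift_grade_def ..
  have "dim_row K = m" "dim_col K = n" using K by auto
  thus ?thesis unfolding parity_definite_def using b[rule_format] by (cases b) simp_all
qed

lemma shift_grade_mult_left:
  assumes W: "W \<in> carrier_mat m k" and P: "P \<in> carrier_mat k n"
    and g: "\<And>i j. i < m \<Longrightarrow> j < k \<Longrightarrow> W $$ (i, j) \<noteq> 0 \<Longrightarrow> r' i = r j" and s: "shift_grade k n P r c"
  shows "shift_grade m n (W * P) r' c"
proof -
  obtain b where b: "\<forall>y<k. \<forall>x<n. P $$ (y, x) \<noteq> 0 \<longrightarrow> (r y = c x) = b"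
    using s unfolding shift_grade_def ..
  have "(r' i = c x) = b" if ix: "i < m" "x < n" and nz: "(W * P) $$ (i, x) \<noteq> 0" for i x
  proof -
    obtain j where "j < k" "W $$ (i, j) * P $$ (j, x) \<noteq> 0"
      using nz unfolding mat_mult_index[OF W P ix] by (metis (no_types, lifting) lessThan_iff sum.neutral)
    thus ?thesis using g[of i j] b[rule_format, of j x] ix by auto
  qed
  thus ?thesis unfolding shift_grade_def by (intro exI[of _ b]) simp
qed

lemma shift_grade_mult_right:
  assumes W: "W \<in> carrier_mat k n" and P: "P \<in> carrier_mat m k"
    and g: "\<And>i j. i < k \<Longrightarrow> j < n \<Longrightarrow> W $$ (i, j) \<noteq> 0 \<Longrightarrow> c' j = c i" and s: "shift_grade m k P r c"
  shows "shift_grade m n (P * W) r c'"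
proof -
  obtain b where b: "\<forall>y<m. \<forall>x<k. P $$ (y, x) \<noteq> 0 \<longrightarrow> (r y = c x) = b"
    using s unfolding shift_grade_def ..
  have "(r y = c' j) = b" if yj: "y < m" "j < n" and nz: "(P * W) $$ (y, j) \<noteq> 0" for y j
  proof -
    obtain i where "i < k" "P $$ (y, i) * W $$ (i, j) \<noteq> 0"
      using nz unfolding mat_mult_index[OF P W yj] by (metis (no_types, lifting) lessThan_iff sum.neutral)
    thus ?thesis using g[of i j] b[rule_format, of y i] yj by auto
  qed
  thus ?thesis unfolding shift_grade_def by (intro exI[of _ b]) simp
qed

lemma parity_preserving_injection:
  fixes g :: "nat \<Rightarrow> bool"
  assumes T: "finite T" and card: "card T \<le> 2 ^ m"
  obtains e where "inj_on e T" "\<And>x. x \<in> T \<Longrightarrow> e x < 2 ^ Suc m" "\<And>x. x \<in> T \<Longrightarrow> odd_occ (e x) = g x"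
proof -
  have "card T \<le> card {..<(2::nat) ^ m}" using card by simp
  then obtain f where f: "inj_on f T" "f ` T \<subseteq> {..<(2::nat) ^ m}"
    using inj_on_iff_card_le[OF T] by blast
  \<comment> \<open>The appended last bit corrects the parity; halving recovers \<open>f x\<close>,
    so injectivity survives.\<close>
  define e where "e x = f x * 2 ^ 1 + (if odd_occ (f x) = g x then 0 else 1)" for x
  have odd_one: "odd_occ (Suc 0)"
    by (simp add: odd_occ_def popcount.simps[of "Suc 0"] popcount.simps[of 0])
  have "odd_occ (e x) = g x" for x
    unfolding e_def by (subst odd_occ_append) (auto simp: odd_one)
  moreover have "e x < 2 ^ Suc m" if "x \<in> T" for x
    using f(2) that by (auto simp: e_def image_subset_iff)
  moreover have "e x div 2 = f x" for x by (simp add: e_def)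
  hence "inj_on e T" using f(1) by (metis inj_on_def)
  ultimately show ?thesis using that by blast
qed

theorem coding_scheme_exists:
  assumes pe: "parity_eigenbasis n \<rho> W q g" and T: "T \<subseteq> {..<2 ^ n}" and card: "card T \<le> 2 ^ m"
  obtains Es Ds where "ferm_channel n (Suc m) Es" "ferm_channel (Suc m) n Ds"
    "ent_fidelity n \<rho> (compose_channels Ds Es) \<ge> (\<Sum>x\<in>T. q x)\<^sup>2"
proof -
  let ?n = "2 ^ n :: nat" and ?m = "2 ^ Suc m :: nat"
  have W: "unitary_mat ?n W" and q: "\<And>x. x < ?n \<Longrightarrow> q x \<ge> 0"
    and g: "\<And>i j. i < ?n \<Longrightarrow> j < ?n \<Longrightarrow> W $$ (i, j) \<noteq> 0 \<Longrightarrow> odd_occ i = g j"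
    using pe by (auto simp: parity_eigenbasis_def)
  have Wc: "W \<in> carrier_mat ?n ?n" and WW: "mat_adjoint W * W = 1\<^sub>m ?n"
    using W by (auto simp: unitary_mat_def)
  note WW' = unitary_mat_right[OF W]
  have finT: "finite T" using T finite_subset by blast
  obtain e where e: "inj_on e T" "\<And>x. x \<in> T \<Longrightarrow> e x < ?m" "\<And>x. x \<in> T \<Longrightarrow> odd_occ (e x) = g x"
    using parity_preserving_injection[OF finT card, of g] by blast
  \<comment> \<open>Sends the label of a retained eigenvector to its code word and kills the other
    labels; its adjoint is the core of the decoder.\<close>
  define P where "P = mat ?m ?n (\<lambda>(y, x). if x \<in> T \<and> y = e x then 1 else 0 :: complex)"
  have P: "P \<in> carrier_mat ?m ?n" by (simp add: P_def)
  have PP: "mat_adjoint P * P = mat_diag ?n (\<lambda>x. if x \<in> T then 1 else 0)"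
  proof (rule eq_matI)
    fix i j assume "i < dim_row (mat_diag ?n (\<lambda>x. if x \<in> T then 1 else 0 :: complex))"
      "j < dim_col (mat_diag ?n (\<lambda>x. if x \<in> T then 1 else 0 :: complex))"
    hence ij: "i < ?n" "j < ?n" by auto
    have "(mat_adjoint P * P) $$ (i, j) = (\<Sum>y<?m. if y = e i then (if i = j \<and> i \<in> T then 1 else 0) else 0)"
      unfolding mat_mult_index[OF mat_adjoint_carrier[OF P] P ij]
      using ij e(1) by (intro sum.cong) (auto simp: P_def inj_on_def)
    thus "(mat_adjoint P * P) $$ (i, j) = mat_diag ?n (\<lambda>x. if x \<in> T then 1 else 0) $$ (i, j)"
      using ij e(2) by (simp del: power_Suc)
  qed (use P in auto)
  have PP': "P * mat_adjoint P = mat_diag ?m (\<lambda>y. if y \<in> e ` T then 1 else 0)"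
  proof (rule eq_matI)
    fix i j assume "i < dim_row (mat_diag ?m (\<lambda>y. if y \<in> e ` T then 1 else 0 :: complex))"
      "j < dim_col (mat_diag ?m (\<lambda>y. if y \<in> e ` T then 1 else 0 :: complex))"
    hence ij: "i < ?m" "j < ?m" by auto
    have "(P * mat_adjoint P) $$ (i, j) = (\<Sum>x<?n. if x \<in> T \<and> i = e x \<and> j = e x then 1 else 0)"
      unfolding mat_mult_index[OF P mat_adjoint_carrier[OF P] ij]
      using ij by (intro sum.cong) (auto simp: P_def)
    also have "\<dots> = (if i = j \<and> i \<in> e ` T then 1 else 0)"
    proof (cases "i = j \<and> i \<in> e ` T")
      case True
      then obtain x0 where x0: "x0 \<in> T" "i = e x0" by blast
      have "(\<Sum>x<?n. if x \<in> T \<and> i = e x \<and> j = e x then 1 else 0) = (\<Sum>x<?n. if x = x0 then 1 else 0 :: complex)"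
        using True x0 e(1) by (intro sum.cong) (auto simp: inj_on_def)
      thus ?thesis using True x0 T by auto
    next
      case False
      thus ?thesis by (subst sum.neutral) auto
    qed
    finally show "(P * mat_adjoint P) $$ (i, j) = mat_diag ?m (\<lambda>y. if y \<in> e ` T then 1 else 0) $$ (i, j)"
      using ij by simp
  qed (use P in auto)
  define Gs where "Gs = complete_kraus ?m ?n T P"
  define Hs where "Hs = complete_kraus ?n ?m (e ` T) (mat_adjoint P)"
  define Es where "Es = map (\<lambda>K. K * mat_adjoint W) Gs"
  define Ds where "Ds = map (\<lambda>K. W * K) Hs"
  have Gc: "K \<in> carrier_mat ?m ?n" if "K \<in> set Gs" for K
    using complete_kraus_carrier[OF P] that by (simp add: Gs_def)
  have Hc: "K \<in> carrier_mat ?n ?m" if "K \<in> set Hs" for K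
    using complete_kraus_carrier[OF mat_adjoint_carrier[OF P]] that by (simp add: Hs_def)
  have Gg: "shift_grade ?m ?n K odd_occ g" if "K \<in> set Gs" for K
    using that e(3) unfolding Gs_def
    by (intro shift_grade_complete_kraus) (auto simp: P_def split: if_splits)
  have Hg: "shift_grade ?n ?m K g odd_occ" if "K \<in> set Hs" for K
    using that e(3) P unfolding Hs_def
    by (intro shift_grade_complete_kraus) (auto simp: P_def split: if_splits)
  have E: "ferm_channel n (Suc m) Es"
    unfolding ferm_channel_def
  proof (intro conjI ballI)
    fix K assume "K \<in> set Es"
    then obtain G where G: "G \<in> set Gs" "K = G * mat_adjoint W" by (auto simp: Es_def)
    show K: "K \<in> carrier_mat ?m ?n"
      unfolding G(2) by (rule mult_carrier_mat[OF Gc[OF G(1)] mat_adjoint_carrier[OF Wc]])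
    have "shift_grade ?m ?n (G * mat_adjoint W) odd_occ odd_occ"
      by (rule shift_grade_mult_right[OF mat_adjoint_carrier[OF Wc] Gc[OF G(1)] _ Gg[OF G(1)]])
        (use g Wc in auto)
    thus "parity_definite K" using parity_definite_shift_grade[OF K] G(2) by simp
  next
    have "mat_adjoint (K * mat_adjoint W) * (K * mat_adjoint W) = W * (mat_adjoint K * K) * mat_adjoint W"
      if "K \<in> set Gs" for K
    proof -
      note K = Gc[OF that]
      have "mat_adjoint (K * mat_adjoint W) * (K * mat_adjoint W) = W * mat_adjoint K * (K * mat_adjoint W)"
        by (simp add: mat_adjoint_mult[OF K mat_adjoint_carrier[OF Wc]])
      also have "\<dots> = W * mat_adjoint K * K * mat_adjoint W"
        by (rule assoc_mult_mat[symmetric, of _ ?n ?m _ ?n _ ?n]) (use K Wc in \<open>auto intro!: mult_carrier_mat[of _ ?n ?n]\<close>)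
      also have "W * mat_adjoint K * K = W * (mat_adjoint K * K)"
        by (rule assoc_mult_mat[of _ ?n ?n _ ?m _ ?n]) (use K Wc in auto)
      finally show ?thesis .
    qed
    hence eq: "map (\<lambda>K. mat_adjoint K * K) Es = map (\<lambda>X. W * X * mat_adjoint W) (map (\<lambda>K. mat_adjoint K * K) Gs)"
      by (simp add: Es_def)
    have Gcar: "X \<in> carrier_mat ?n ?n" if "X \<in> set (map (\<lambda>K. mat_adjoint K * K) Gs)" for X
      using that mult_carrier_mat[OF mat_adjoint_carrier[OF Gc] Gc] by auto
    have "msum ?n (map (\<lambda>K. mat_adjoint K * K) Es)
        = W * msum ?n (map (\<lambda>K. mat_adjoint K * K) Gs) * mat_adjoint W"
      unfolding eq by (rule msum_sandwich[OF Wc mat_adjoint_carrier[OF Wc] Gcar, symmetric])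
    also have "msum ?n (map (\<lambda>K. mat_adjoint K * K) Gs) = 1\<^sub>m ?n"
      unfolding Gs_def by (rule complete_kraus_sum[OF P _ PP]) simp
    finally show "msum ?n (map (\<lambda>K. mat_adjoint K * K) Es) = 1\<^sub>m ?n"
      using Wc WW' by simp
  qed
  have D: "ferm_channel (Suc m) n Ds"
    unfolding ferm_channel_def
  proof (intro conjI ballI)
    fix K assume "K \<in> set Ds"
    then obtain H where H: "H \<in> set Hs" "K = W * H" by (auto simp: Ds_def)
    show K: "K \<in> carrier_mat ?n ?m" unfolding H(2) by (rule mult_carrier_mat[OF Wc Hc[OF H(1)]])
    have "shift_grade ?n ?m (W * H) odd_occ odd_occ"
      by (rule shift_grade_mult_left[OF Wc Hc[OF H(1)] g Hg[OF H(1)]])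
    thus "parity_definite K" using parity_definite_shift_grade[OF K] H(2) by simp
  next
    have "mat_adjoint (W * K) * (W * K) = mat_adjoint K * K" if "K \<in> set Hs" for K
    proof -
      note K = Hc[OF that]
      have "mat_adjoint (W * K) * (W * K) = mat_adjoint K * mat_adjoint W * (W * K)"
        by (simp add: mat_adjoint_mult[OF Wc K])
      also have "\<dots> = mat_adjoint K * (mat_adjoint W * (W * K))"
        by (rule assoc_mult_mat[of _ ?m ?n _ ?n _ ?m]) (use K Wc in auto)
      also have "mat_adjoint W * (W * K) = mat_adjoint W * W * K"
        by (rule assoc_mult_mat[symmetric, of _ ?n ?n _ ?n _ ?m]) (use K Wc in auto)
      finally show ?thesis using K by (simp add: WW)
    qed
    hence "map (\<lambda>K. mat_adjoint K * K) Ds = map (\<lambda>K. mat_adjoint K * K) Hs" by (simp add: Ds_def)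
    thus "msum ?m (map (\<lambda>K. mat_adjoint K * K) Ds) = 1\<^sub>m ?m"
      using complete_kraus_sum[OF mat_adjoint_carrier[OF P], of "e ` T"] PP' by (simp add: Hs_def)
  qed
  \<comment> \<open>The leading operators of decoder and encoder compose to the projector onto the
    retained eigenvectors. This pair alone yields the bound; every other pair adds a nonnegative
    term.\<close>
  have c00: "mat_adjoint W * (Ds ! 0 * Es ! 0) * W = mat_diag ?n (\<lambda>x. if x \<in> T then 1 else 0)"
  proof -
    have P': "mat_adjoint P \<in> carrier_mat ?n ?m" and W': "mat_adjoint W \<in> carrier_mat ?n ?n" using P Wc by auto
    have "Ds ! 0 * Es ! 0 = (W * mat_adjoint P) * (P * mat_adjoint W)"
      by (simp add: Ds_def Es_def Gs_def Hs_def complete_kraus_def)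
    also have "\<dots> = W * (mat_adjoint P * (P * mat_adjoint W))"
      by (rule assoc_mult_mat[OF Wc P' mult_carrier_mat[OF P W']])
    also have "mat_adjoint P * (P * mat_adjoint W) = mat_adjoint P * P * mat_adjoint W"
      by (rule assoc_mult_mat[OF P' P W', symmetric])
    finally have "Ds ! 0 * Es ! 0 = W * (mat_diag ?n (\<lambda>x. if x \<in> T then 1 else 0) * mat_adjoint W)"
      unfolding PP .
    moreover have "mat_adjoint W * (W * (R * mat_adjoint W)) * W = R" if R: "R \<in> carrier_mat ?n ?n" for R
    proof -
      have "mat_adjoint W * (W * (R * mat_adjoint W)) * W = (mat_adjoint W * W) * (R * (mat_adjoint W * W))"
        using Wc R by (simp add: assoc_mult_mat[of _ ?n ?n _ ?n _ ?n] mult_carrier_mat[of _ ?n ?n _ ?n])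
      thus ?thesis using R by (simp add: WW)
    qed
    ultimately show ?thesis by simp
  qed
  have ne: "0 < length Ds" "0 < length Es" using ferm_channelD(3)[OF D] ferm_channelD(3)[OF E] by auto
  let ?F = "\<lambda>i j. (cmod (\<Sum>x<?n. of_real (q x) * (mat_adjoint W * (Ds ! i * Es ! j) * W) $$ (x, x)))\<^sup>2"
  have "(\<Sum>x<?n. of_real (q x) * (mat_adjoint W * (Ds ! 0 * Es ! 0) * W) $$ (x, x))
      = (\<Sum>x<?n. if x \<in> T then complex_of_real (q x) else 0)"
    unfolding c00 by (intro sum.cong) auto
  also have "\<dots> = of_real (\<Sum>x\<in>T. q x)"
    using T by (simp add: sum.If_cases Int_absorb1)
  finally have "?F 0 0 = (\<Sum>x\<in>T. q x)\<^sup>2" by (simp add: norm_of_real del: of_real_sum)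
  hence "(\<Sum>x\<in>T. q x)\<^sup>2 = ?F 0 0" by simp
  also have "\<dots> \<le> (\<Sum>j<length Es. ?F 0 j)" using ne by (intro member_le_sum) auto
  also have "\<dots> \<le> (\<Sum>i<length Ds. \<Sum>j<length Es. ?F i j)"
    using ne by (intro member_le_sum[of 0 _ "\<lambda>i. \<Sum>j<length Es. ?F i j"] sum_nonneg) auto
  also have "\<dots> = ent_fidelity n \<rho> (compose_channels Ds Es)"
    by (rule ent_fidelity_compose[OF pe E D, symmetric])
  finally show ?thesis using that[OF E D] by blast
qed

subsection \<open>The fermionic source coding theorem\<close>

lemma ferm_state_parity_eigenbasis:
  assumes \<rho>: "normalized_ferm_state L \<rho>"
  obtains p where "\<And>i. i < 2 ^ L \<Longrightarrow> p i \<ge> 0" "(\<Sum>i<2 ^ L. p i) = 1"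
    "vn_entropy \<rho> = - (\<Sum>i<2 ^ L. eta (p i))"
    "\<And>N. \<exists>W g. parity_eigenbasis (L * N) (kron_pow \<rho> N) W (prod_weight p (2 ^ L) N) g"
proof -
  note st = normalized_ferm_stateD[OF \<rho>]
  have c: "\<rho> \<in> carrier_mat (2 ^ L) (2 ^ L)" using st(1) by (simp add: psd_def)
  obtain U p g where U: "unitary_mat (2 ^ L) U" and RU: "\<rho> * U = U * mat_diag (2 ^ L) (\<lambda>i. complex_of_real (p i))"
    and p: "\<And>j. j < 2 ^ L \<Longrightarrow> p j \<ge> 0"
    and g: "\<And>i j. i < 2 ^ L \<Longrightarrow> j < 2 ^ L \<Longrightarrow> U $$ (i, j) \<noteq> 0 \<Longrightarrow> odd_occ i = (g j :: bool)"
    using psd_graded_eigenbasis[of "2 ^ L" \<rho> odd_occ] st(1,3) by metis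
  have Uc: "U \<in> carrier_mat (2 ^ L) (2 ^ L)" using U by (rule unitary_mat_carrier)
  have "complex_of_real (\<Sum>i<2 ^ L. p i) = 1"
    using mtrace_eigenvalues[OF U c RU] st(2) by simp
  hence p1: "(\<Sum>i<2 ^ L. p i) = 1" using of_real_eq_1_iff by blast
  have gr: "odd_occ i = xor_grade g (2 ^ L) N j"
    if "i < (2 ^ L) ^ N" "j < (2 ^ L) ^ N" "kron_pow U N $$ (i, j) \<noteq> 0" for N i j
    using kron_pow_graded[OF Uc _ that] g by blast
  have "parity_eigenbasis (L * N) (kron_pow \<rho> N) (kron_pow U N) (prod_weight p (2 ^ L) N) (xor_grade g (2 ^ L) N)" for N
    using unitary_mat_kron_pow[OF U, of N] kron_pow_carrier[OF c, of N] kron_pow_eigenbasis[OF c Uc RU, of N]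
      gr[of _ N] prod_weight_nonneg[where p = p and d = "2 ^ L", OF p p1] prod_weight_sum[where p = p and d = "2 ^ L", OF p p1, of N]
    unfolding parity_eigenbasis_def power_mult by simp
  thus ?thesis using that[of p] p p1 vn_entropy_eigenvalues[OF U c RU] by blast
qed

lemma scheme_rate_eq: "scheme_rate N M = real M / real N"
  by (simp add: scheme_rate_def log_nat_power)

theorem theorem1:
  fixes L :: nat and \<rho> :: "complex mat"
  assumes "normalized_ferm_state L \<rho>"
  shows "(\<forall>\<delta> > 0. \<forall>R. R > vn_entropy \<rho> \<longrightarrow>
            (\<exists>N0. \<forall>N \<ge> N0. \<exists>M Es Ds. compression_scheme L N M Es Ds \<and> scheme_rate N M \<le> R \<and>
               ent_fidelity (L * N) (kron_pow \<rho> N) (compose_channels Ds Es) \<ge> 1 - \<delta>))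
       \<and> (\<forall>R \<delta>. R < vn_entropy \<rho> \<longrightarrow> \<delta> > 0 \<longrightarrow>
            (\<exists>N0. \<forall>N \<ge> N0. \<forall>M Es Ds. compression_scheme L N M Es Ds \<and> scheme_rate N M \<le> R \<longrightarrow>
               ent_fidelity (L * N) (kron_pow \<rho> N) (compose_channels Ds Es) \<le> \<delta>))"
proof -
  obtain p where p: "\<And>i. i < 2 ^ L \<Longrightarrow> p i \<ge> 0" "(\<Sum>i<2 ^ L. p i) = 1"
    and S: "vn_entropy \<rho> = - (\<Sum>i<2 ^ L. eta (p i))"
    and basis: "\<And>N. \<exists>W g. parity_eigenbasis (L * N) (kron_pow \<rho> N) W (prod_weight p (2 ^ L) N) g"
    using ferm_state_parity_eigenbasis[OF assms] by blast
  define w where "w N = prod_weight p (2 ^ L) N" for N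
  have w0: "w N x \<ge> 0" if "x < 2 ^ (L * N)" for N x
    using prod_weight_nonneg[where p = p and d = "2 ^ L", OF p] that by (simp add: w_def power_mult)
  have w1: "(\<Sum>x<2 ^ (L * N). w N x) = 1" for N
    using prod_weight_sum[where p = p and d = "2 ^ L", OF p] by (simp add: w_def power_mult)
  have "eta (p i) \<le> 0" if "i < 2 ^ L" for i
  proof -
    have "p i \<le> 1" using member_le_sum[of i "{..<2 ^ L}" p] p that by auto
    thus ?thesis using p(1)[OF that] by (auto simp: eta_def mult_le_0_iff)
  qed
  \<comment> \<open>Makes \<open>N * R\<close> at least 2 in the direct part, so that the
    natural-number subtraction defining \<open>M\<close> does not truncate.\<close>
  hence S0: "vn_entropy \<rho> \<ge> 0" unfolding S by (auto intro!: sum_nonpos)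
  note aep = atypical_weight_tendsto_0[where p = p and d = "2 ^ L", OF p, folded S w_def, unfolded power_mult[symmetric]]
  have direct: "\<exists>N0. \<forall>N \<ge> N0. \<exists>M Es Ds. compression_scheme L N M Es Ds \<and> scheme_rate N M \<le> R \<and>
      ent_fidelity (L * N) (kron_pow \<rho> N) (compose_channels Ds Es) \<ge> 1 - \<delta>"
    if \<delta>: "\<delta> > 0" and R: "R > vn_entropy \<rho>" for \<delta> R
  proof -
    \<comment> \<open>One half of the gap pays for typicality, the other for rounding and the parity
      mode.\<close>
    define \<epsilon> where "\<epsilon> = (R - vn_entropy \<rho>) / 2"
    have \<epsilon>: "\<epsilon> > 0" using R by (simp add: \<epsilon>_def)
    obtain N0 where N0: "\<And>N. N \<ge> N0 \<Longrightarrow>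
        (\<Sum>x | x < 2 ^ (L * N) \<and> w N x < 2 powr (- (N * (vn_entropy \<rho> + \<epsilon>))). w N x) \<le> \<delta> / 2"
      using aep[OF _ \<epsilon> half_gt_zero[OF \<delta>]] by blast
    \<comment> \<open>Ensures \<open>N * \<epsilon> \<ge> 2\<close>: less than one mode is lost to
      rounding and exactly one to parity.\<close>
    define N1 where "N1 = max N0 (Suc (nat \<lceil>2 / \<epsilon>\<rceil>))"
    show ?thesis
    proof (rule exI[of _ N1], intro allI impI)
      fix N assume N: "N \<ge> N1"
      have "2 / \<epsilon> \<le> real (nat \<lceil>2 / \<epsilon>\<rceil>)" by (rule real_nat_ceiling_ge)
      hence N2: "2 / \<epsilon> \<le> N" and Npos: "N > 0" and NN0: "N \<ge> N0" using N by (auto simp: N1_def)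
      have N\<epsilon>: "2 \<le> N * \<epsilon>" using N2 \<epsilon> by (simp add: field_simps)
      define t where "t = 2 powr (- (N * (vn_entropy \<rho> + \<epsilon>)))"
      define T where "T = {x. x < 2 ^ (L * N) \<and> w N x \<ge> t}"
      have t: "t > 0" by (simp add: t_def)
      have un: "{..<2 ^ (L * N)} = T \<union> {x. x < 2 ^ (L * N) \<and> w N x < t}" by (auto simp: T_def)
      have "(\<Sum>x<2 ^ (L * N). w N x) = (\<Sum>x\<in>T. w N x) + (\<Sum>x | x < 2 ^ (L * N) \<and> w N x < t. w N x)"
        unfolding un by (rule sum.union_disjoint) (auto simp: T_def)
      hence mass: "(\<Sum>x\<in>T. w N x) \<ge> 1 - \<delta> / 2" using N0[OF NN0] w1[of N] by (simp add: t_def)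
      have NR: "N * R = N * (vn_entropy \<rho> + \<epsilon>) + N * \<epsilon>" by (simp add: \<epsilon>_def field_simps)
      have "N * (vn_entropy \<rho> + \<epsilon>) \<ge> 0" using S0 \<epsilon> by simp
      hence "N * R \<ge> 2" using NR N\<epsilon> by linarith
      \<comment> \<open>The scheme uses \<open>Suc M\<close> modes, the floor of
        \<open>N * R\<close>; the remaining \<open>M\<close> must still exceed
        \<open>N * (vn_entropy \<rho> + \<epsilon>)\<close>, which is at most
        \<open>N * R - 2\<close>.\<close>
      define M where "M = nat \<lfloor>N * R\<rfloor> - 1"
      have M: "real (Suc M) \<le> N * R" "N * R < real M + 2"
        using \<open>N * R \<ge> 2\<close> by (auto simp: M_def) linarith+
      \<comment> \<open>Every typical index weighs at least \<open>t\<close> and the total weight is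
        1, so there are at most \<open>1 / t\<close> of them.\<close>
      have "real (card T) * t = (\<Sum>x\<in>T. t)" by simp
      also have "\<dots> \<le> (\<Sum>x\<in>T. w N x)" by (rule sum_mono) (simp add: T_def)
      also have "\<dots> \<le> (\<Sum>x<2 ^ (L * N). w N x)" by (rule sum_mono2) (auto simp: T_def w0)
      finally have "real (card T) * t \<le> 1" using w1 by simp
      hence "real (card T) \<le> 1 / t" using t by (simp add: field_simps)
      also have "1 / t = 2 powr (N * (vn_entropy \<rho> + \<epsilon>))"
        unfolding t_def powr_minus by (simp only: inverse_eq_divide divide_divide_eq_right mult_1_left div_by_1)
      also have "\<dots> \<le> 2 powr real M" using NR N\<epsilon> M by (intro powr_mono) auto
      also have "\<dots> = real (2 ^ M)" by (simp add: powr_realpow)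
      finally have card: "card T \<le> 2 ^ M" by (simp only: of_nat_le_iff)
      obtain W g where pe: "parity_eigenbasis (L * N) (kron_pow \<rho> N) W (w N) g"
        using basis[of N] by (auto simp: w_def)
      have "T \<subseteq> {..<2 ^ (L * N)}" by (auto simp: T_def)
      then obtain Es Ds where ED: "ferm_channel (L * N) (Suc M) Es" "ferm_channel (Suc M) (L * N) Ds"
        and F: "ent_fidelity (L * N) (kron_pow \<rho> N) (compose_channels Ds Es) \<ge> (\<Sum>x\<in>T. w N x)\<^sup>2"
        using coding_scheme_exists[OF pe _ card] by blast
      \<comment> \<open>Squaring at most doubles the deficit from 1, hence the earlier choice of
        \<open>\<delta> / 2\<close>.\<close>
      have "0 \<le> ((\<Sum>x\<in>T. w N x) - 1)\<^sup>2" by simp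
      hence "(\<Sum>x\<in>T. w N x)\<^sup>2 \<ge> 2 * (\<Sum>x\<in>T. w N x) - 1" by (simp add: power2_eq_square algebra_simps)
      hence "ent_fidelity (L * N) (kron_pow \<rho> N) (compose_channels Ds Es) \<ge> 1 - \<delta>" using F mass by linarith
      moreover have "scheme_rate N (Suc M) \<le> R"
        using M(1) Npos unfolding scheme_rate_eq by (simp add: field_simps)
      ultimately show "\<exists>M Es Ds. compression_scheme L N M Es Ds \<and> scheme_rate N M \<le> R \<and>
          ent_fidelity (L * N) (kron_pow \<rho> N) (compose_channels Ds Es) \<ge> 1 - \<delta>"
        using ED unfolding compression_scheme_def by blast
    qed
  qed
  have "\<exists>N0. \<forall>N \<ge> N0. \<forall>M Es Ds. compression_scheme L N M Es Ds \<and> scheme_rate N M \<le> R \<longrightarrow>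
      ent_fidelity (L * N) (kron_pow \<rho> N) (compose_channels Ds Es) \<le> \<delta>"
    if R: "R < vn_entropy \<rho>" and \<delta>: "\<delta> > 0" for R \<delta>
  proof -
    \<comment> \<open>The threshold exponent then lies midway between the rate and the entropy,
      which leaves \<open>t * 2 ^ M\<close> at most 2 to the power
      \<open>- (N * \<epsilon>)\<close>.\<close>
    define \<epsilon> where "\<epsilon> = (vn_entropy \<rho> - R) / 2"
    \<comment> \<open>The cap at 1 gives \<open>H\<^sup>2 \<le> \<mu>\<close>, so
      \<open>2 * H\<^sup>2\<close> takes at most half of \<delta>.\<close>
    define \<mu> where "\<mu> = min 1 (\<delta> / 4)"
    have \<epsilon>: "\<epsilon> > 0" and \<mu>: "\<mu> > 0" using R \<delta> by (auto simp: \<epsilon>_def \<mu>_def)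
    obtain N0 where N0: "\<And>N. N \<ge> N0 \<Longrightarrow>
        (\<Sum>x | x < 2 ^ (L * N) \<and> w N x > 2 powr (- (N * (vn_entropy \<rho> - \<epsilon>))). w N x) \<le> \<mu>"
      using aep[OF _ \<epsilon> \<mu>] by blast
    \<comment> \<open>Brings \<open>t * 2 ^ M\<close> down to \<open>\<delta> / 4\<close>. The
      successor excludes \<open>N = 0\<close>, where division by zero makes the rate 0 and leaves
      \<open>M\<close> unbounded.\<close>
    define N1 where "N1 = max N0 (Suc (nat \<lceil>log 2 (4 / \<delta>) / \<epsilon>\<rceil>))"
    show ?thesis
    proof (rule exI[of _ N1], intro allI impI)
      fix N M Es Ds assume N: "N \<ge> N1" and sch: "compression_scheme L N M Es Ds \<and> scheme_rate N M \<le> R"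
      have "log 2 (4 / \<delta>) / \<epsilon> \<le> real (nat \<lceil>log 2 (4 / \<delta>) / \<epsilon>\<rceil>)" by (rule real_nat_ceiling_ge)
      hence N2: "log 2 (4 / \<delta>) / \<epsilon> \<le> N" and Npos: "N > 0" and NN0: "N \<ge> N0" using N by (auto simp: N1_def)
      have N\<epsilon>: "log 2 (4 / \<delta>) \<le> N * \<epsilon>" using N2 \<epsilon> by (simp add: field_simps)
      define t where "t = 2 powr (- (N * (vn_entropy \<rho> - \<epsilon>)))"
      define H where "H = (\<Sum>x | x < 2 ^ (L * N) \<and> w N x > t. w N x)"
      have H: "0 \<le> H" "H \<le> \<mu>"
        using N0[OF NN0] w0 by (auto simp: H_def t_def intro!: sum_nonneg)
      have "H\<^sup>2 \<le> \<mu> * 1" unfolding power2_eq_square using H \<mu> by (intro mult_mono) (auto simp: \<mu>_def)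
      hence H2: "2 * H\<^sup>2 \<le> \<delta> / 2" by (simp add: \<mu>_def)
      have "real M \<le> N * R" using sch Npos unfolding scheme_rate_eq by (simp add: field_simps)
      hence "t * 2 ^ M \<le> t * 2 powr (N * R)"
        by (intro mult_left_mono) (auto simp: t_def simp flip: powr_realpow)
      also have "\<dots> = 2 powr (- (N * \<epsilon>))"
        unfolding t_def powr_add[symmetric]
        by (rule arg_cong[where f = "(powr) 2"]) (simp add: \<epsilon>_def field_simps)
      also have "\<dots> \<le> 2 powr (- log 2 (4 / \<delta>))" using N\<epsilon> by (intro powr_mono) auto
      also have "\<dots> = \<delta> / 4" using \<delta> by (simp add: powr_minus)
      finally have tM: "2 * (t * 2 ^ M) \<le> \<delta> / 2" by simp
      obtain W g where pe: "parity_eigenbasis (L * N) (kron_pow \<rho> N) W (w N) g"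
        using basis[of N] by (auto simp: w_def)
      have "ent_fidelity (L * N) (kron_pow \<rho> N) (compose_channels Ds Es) \<le> 2 * H\<^sup>2 + 2 * (t * 2 ^ M)"
        unfolding H_def using sch
        by (intro ent_fidelity_upper_bound[OF pe]) (auto simp: compression_scheme_def t_def)
      thus "ent_fidelity (L * N) (kron_pow \<rho> N) (compose_channels Ds Es) \<le> \<delta>" using H2 tM by linarith
    qed
  qed
  with direct show ?thesis by blast
qed

end
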